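(* Let $X$ be a proper metric space with a consistent bicombing $\sigma$ and with cocompact isometry group. Then $X$ is hyperbolic if and only if $X$ does not contain an isometrically embedded normed plane.
   Context: Bicombing: for a metric space $(X,d)$, a bicombing is a map $\sigma\colon X\times X\times[0,1]\to X$ such that the maps $\sigma_{xy}:=\sigma(x,y,\cdot)\colon[0,1]\to X$ satisfy, for all $x,y,x',y'\in X$: (i) $\sigma_{xy}(0)=x$, $\sigma_{xy}(1)=y$, and $d(\sigma_{xy}(t),\sigma_{xy}(t'))=|t-t'|\,d(x,y)$ for $t,t'\in[0,1]$; (ii) $\sigma_{yx}(t)=\sigma_{xy}(1-t)$ for $t\in[0,1]$; (iii) $d(\sigma_{xy}(t),\sigma_{x'y'}(t))\le(1-t)\,d(x,x')+t\,d(y,y')$ for $t\in[0,1]$. The bicombing is consistent if in addition (iv) $\operatorname{im}(\sigma_{pq})\subset\operatorname{im}(\sigma_{xy})$ whenever $p=\sigma_{xy}(r)$ and $q=\sigma_{xy}(s)$ with $r\le s$. A metric space is proper if its closed balls are compact. The isometry group of $X$ is cocompact if there is a compact set $K\subset X$ such that $X$ is the union of the images $\gamma(K)$ over all isometries $\gamma$ of $X$ (isometries of $X$ are distance-preserving bijections $X\to X$). $X$ is hyperbolic if there is a constant $\delta\ge 0$ such that $d(w,y)+d(x,z)\le\max\{d(w,x)+d(y,z),\,d(w,z)+d(x,y)\}+2\delta$ for every $(w,x,y,z)\in X^4$. An isometrically embedded normed plane in $X$ is the image of a distance-preserving map $(\mathbb{R}^2,\|\cdot\|)\to X$ for some norm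 $\|\cdot\|$ on $\mathbb{R}^2$. *)

theory Defs
  imports "HOL-Analysis.Analysis"
begin

text \<open>The metric space \<open>X\<close> is the universe of a type of class \<^class>\<open>metric_space\<close>; its global
  properties are predicates on the corresponding \<open>itself\<close> type.\<close>

definition proper_metric_space :: "'a::metric_space itself \<Rightarrow> bool" where
  "proper_metric_space T \<longleftrightarrow> (\<forall>(x::'a) r. compact (cball x r))"

definition isometry :: "('a::metric_space \<Rightarrow> 'a) \<Rightarrow> bool" where
  "isometry g \<longleftrightarrow> bij g \<and> (\<forall>x y. dist (g x) (g y) = dist x y)"

definition cocompact_isometry_group :: "'a::metric_space itself \<Rightarrow> bool" where
  "cocompact_isometry_group T \<longleftrightarrow>
     (\<exists>K::'a set. compact K \<and> (\<Union>g\<in>{g. isometry g}. g ` K) = UNIV)"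

text \<open>The value \<open>\<sigma> x y t\<close> stands for \<open>\<sigma>\<^sub>x\<^sub>y(t)\<close>. As the parameter ranges over the whole
  type of reals, values for \<open>t\<close> outside \<open>[0,1]\<close> are irrelevant and left unconstrained.\<close>

definition bicombing :: "('a::metric_space \<Rightarrow> 'a \<Rightarrow> real \<Rightarrow> 'a) \<Rightarrow> bool" where
  "bicombing \<sigma> \<longleftrightarrow>
     (\<forall>x y. \<sigma> x y 0 = x \<and> \<sigma> x y 1 = y \<and>
        (\<forall>t\<in>{0..1}. \<forall>t'\<in>{0..1}. dist (\<sigma> x y t) (\<sigma> x y t') = \<bar>t - t'\<bar> * dist x y)) \<and>
     (\<forall>x y. \<forall>t\<in>{0..1}. \<sigma> y x t = \<sigma> x y (1 - t)) \<and>
     (\<forall>x y x' y'. \<forall>t\<in>{0..1}.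
        dist (\<sigma> x y t) (\<sigma> x' y' t) \<le> (1 - t) * dist x x' + t * dist y y')"

definition consistent_bicombing :: "('a::metric_space \<Rightarrow> 'a \<Rightarrow> real \<Rightarrow> 'a) \<Rightarrow> bool" where
  "consistent_bicombing \<sigma> \<longleftrightarrow> bicombing \<sigma> \<and>
     (\<forall>x y p q. \<forall>r\<in>{0..1}. \<forall>s\<in>{0..1}. r \<le> s \<and> p = \<sigma> x y r \<and> q = \<sigma> x y s \<longrightarrow>
        \<sigma> p q ` {0..1} \<subseteq> \<sigma> x y ` {0..1})"

definition hyperbolic_space :: "'a::metric_space itself \<Rightarrow> bool" where
  "hyperbolic_space T \<longleftrightarrow>
     (\<exists>\<delta>\<ge>0. \<forall>w x y z :: 'a.
        dist w y + dist x z \<le> max (dist w x + dist y z) (dist w z + dist x y) + 2 * \<delta>)"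

text \<open>An arbitrary norm on a real vector space, as opposed to the fixed \<^const>\<open>norm\<close> of the type.\<close>

definition is_norm :: "('v::real_vector \<Rightarrow> real) \<Rightarrow> bool" where
  "is_norm N \<longleftrightarrow>
     (\<forall>u. 0 \<le> N u) \<and> (\<forall>u. N u = 0 \<longleftrightarrow> u = 0) \<and>
     (\<forall>c u. N (c *\<^sub>R u) = \<bar>c\<bar> * N u) \<and>
     (\<forall>u v. N (u + v) \<le> N u + N v)"

definition isometrically_embedded_normed_plane :: "'a::metric_space set \<Rightarrow> bool" where
  "isometrically_embedded_normed_plane P \<longleftrightarrow>
     (\<exists>(N :: real^2 \<Rightarrow> real) (f :: real^2 \<Rightarrow> 'a).
        is_norm N \<and> (\<forall>u v. dist (f u) (f v) = N (u - v)) \<and> P = range f)"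

end

theory Submission
  imports Defs
begin

text \<open>
  The forward direction applies the four-point inequality to \<open>\<plusminus>a, \<plusminus>b\<close> in a normed plane, for large
  multiples and then for the pair \<open>a + b, a - b\<close>.

  Conversely, suppose that \<open>X\<close> is not hyperbolic. A combing triangle whose fatness \<open>D\<close> is large, cut
  down near its fattest point, yields a hexagon with sides of length \<open>O(D)\<close> that encloses signed area
  at least \<open>c D\<^sup>2\<close> with respect to a Lipschitz map \<open>\<phi>\<close> from \<open>X\<close> to the complex plane; coning it off
  gives a map of an \<open>n \<times> n\<close> grid into \<open>X\<close> with uniformly bounded steps and area at least \<open>c n\<^sup>2\<close>. Among
  all grid maps with bounded steps take one that almost minimises a large sum of energies
  \<open>\<Sum>\<^sub>p d(F(p), F(p + v))\<^sup>2\<close>, over many directions \<open>v\<close>, minus a multiple of the area. Replacing \<open>F(p)\<close>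
  by the midpoint of \<open>F(p)\<close> and \<open>F(p + v)\<close> does not increase any of the energies, bounds the one in
  direction \<open>v\<close> by a quarter of the energy in direction \<open>2 v\<close>, and changes the area only by \<open>O(n)\<close>,
  because the area is determined by the boundary. Hence for most \<open>p\<close> the point \<open>F(p + v)\<close> is almost a
  midpoint of \<open>F(p)\<close> and \<open>F(p + 2 v)\<close>. Refining the mesh and moving such places into a compact set by
  isometries, one gets in the limit a map of the plane into \<open>X\<close> that preserves midpoints metrically.
  The distance in \<open>X\<close> then pulls back to a translation-invariant seminorm, and the remaining area
  prevents that seminorm from degenerating.
\<close>

section \<open>Signed areas of grid maps\<close>

definition grid :: "nat \<Rightarrow> (int \<times> int) set" where
  "grid n = {0..<int n} \<times> {0..<int n}"

definition size1 :: "int \<times> int \<Rightarrow> real" where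
  "size1 v = real_of_int (\<bar>fst v\<bar> + \<bar>snd v\<bar>)"

lemma size1_nonneg [simp]: "0 \<le> size1 v"
  by (simp add: size1_def)

lemma finite_grid [simp]: "finite (grid n)"
  by (simp add: grid_def)

lemma card_grid: "card (grid n) = n * n"
  by (simp add: grid_def)

section \<open>Sums over shifted windows\<close>

lemma sum_shift_Suc:
  fixes f :: "int \<Rightarrow> real"
  shows "(\<Sum>i\<in>{0..<int n}. f (i + 1)) - (\<Sum>i\<in>{0..<int n}. f i) = f (int n) - f 0"
proof (induction n)
  case (Suc n)
  have "{0..<int (Suc n)} = insert (int n) {0..<int n}" by auto
  then show ?case using Suc by (simp add: add.commute)
qed simp

lemma sum_shift_nat:
  fixes f :: "int \<Rightarrow> real"
  assumes "\<And>i. \<bar>f i\<bar> \<le> B"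
  shows "\<bar>(\<Sum>i\<in>{0..<int n}. f (i + int k)) - (\<Sum>i\<in>{0..<int n}. f i)\<bar> \<le> 2 * B * k"
proof (induction k)
  case (Suc k)
  have "(\<Sum>i\<in>{0..<int n}. f (i + int (Suc k))) - (\<Sum>i\<in>{0..<int n}. f (i + int k))
      = f (int n + int k) - f (int k)"
    using sum_shift_Suc[of "\<lambda>i. f (i + int k)" n] by (simp add: algebra_simps)
  moreover have "\<bar>f (int n + int k) - f (int k)\<bar> \<le> 2 * B"
    using assms[of "int n + int k"] assms[of "int k"] by linarith
  ultimately show ?case using Suc by (simp add: algebra_simps)
qed simp

lemma sum_shift_int:
  fixes f :: "int \<Rightarrow> real"
  assumes "\<And>i. \<bar>f i\<bar> \<le> B"
  shows "\<bar>(\<Sum>i\<in>{0..<int n}. f (i + k)) - (\<Sum>i\<in>{0..<int n}. f i)\<bar> \<le> 2 * B * \<bar>k\<bar>"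
proof (cases "k \<ge> 0")
  case True
  then show ?thesis using sum_shift_nat[OF assms, where n = n and k = "nat k"] by simp
next
  case False
  then show ?thesis
    \<comment> \<open>A negative shift of \<open>f\<close> is the positive shift by
      \<open>- k\<close> of the translate \<open>\<lambda>i. f (i + k)\<close>, which has the same
      bound.\<close>
    using sum_shift_nat[where f = "\<lambda>i. f (i + k)" and B = B and n = n and k = "nat (- k)"] assms
    by (simp add: abs_minus_commute)
qed

text \<open>Telescoping in each coordinate leaves only values near the border of the window. The
  cost is linear in n, whereas areas and energies grow like n^2; this is the source of the linear
  error terms below.\<close>

lemma sum_grid_shift:
  fixes f :: "int \<times> int \<Rightarrow> real"
  assumes B: "\<And>p. \<bar>f p\<bar> \<le> B"
  shows "\<bar>(\<Sum>p\<in>grid n. f (p + q)) - (\<Sum>p\<in>grid n. f p)\<bar> \<le> 2 * B * n * size1 q"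
proof -
  obtain a b where q: "q = (a, b)" by (cases q)
  let ?I = "{0..<int n}"
  have "\<bar>(\<Sum>i\<in>?I. \<Sum>j\<in>?I. f (i + a, j + b)) - (\<Sum>i\<in>?I. \<Sum>j\<in>?I. f (i + a, j))\<bar>
      \<le> (\<Sum>i\<in>?I. 2 * B * \<bar>b\<bar>)"
    unfolding sum_subtractf[symmetric, of "\<lambda>i. \<Sum>j\<in>?I. f (i + a, j + b)"]
    by (intro order.trans[OF sum_abs] sum_mono sum_shift_int[where f = "\<lambda>j. f (_, j)"] B)
  moreover have "\<bar>(\<Sum>j\<in>?I. \<Sum>i\<in>?I. f (i + a, j)) - (\<Sum>j\<in>?I. \<Sum>i\<in>?I. f (i, j))\<bar>
      \<le> (\<Sum>i\<in>?I. 2 * B * \<bar>a\<bar>)"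
    unfolding sum_subtractf[symmetric, of "\<lambda>j. \<Sum>i\<in>?I. f (i + a, j)"]
    by (intro order.trans[OF sum_abs] sum_mono sum_shift_int[where f = "\<lambda>i. f (i, _)"] B)
  moreover have "(\<Sum>p\<in>grid n. f (p + q)) = (\<Sum>i\<in>?I. \<Sum>j\<in>?I. f (i + a, j + b))"
    unfolding grid_def q sum.cartesian_product by (rule sum.cong) auto
  moreover have "(\<Sum>p\<in>grid n. f p) = (\<Sum>j\<in>?I. \<Sum>i\<in>?I. f (i, j))"
    by (subst sum.swap) (simp add: grid_def sum.cartesian_product)
  moreover have "(\<Sum>i\<in>?I. \<Sum>j\<in>?I. f (i + a, j)) = (\<Sum>j\<in>?I. \<Sum>i\<in>?I. f (i + a, j))"
    by (rule sum.swap)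
  ultimately show ?thesis
    by (simp add: q size1_def algebra_simps abs_le_iff)
qed

section \<open>Signed areas via determinants\<close>

definition cross :: "complex \<Rightarrow> complex \<Rightarrow> real" where
  "cross a b = Im (cnj a * b)"

text \<open>Twice the signed area of a quadrilateral, computed from its diagonals.\<close>

definition quad :: "complex \<Rightarrow> complex \<Rightarrow> complex \<Rightarrow> complex \<Rightarrow> real" where
  "quad a b c d = cross (c - a) (d - b)"

text \<open>The sides \<open>u\<close> and \<open>w\<close> are left arbitrary so that coarse cells
  of mesh k can be compared with unit cells.\<close>

definition cell :: "int \<times> int \<Rightarrow> int \<times> int \<Rightarrow> (int \<times> int \<Rightarrow> complex) \<Rightarrow> int \<times> int \<Rightarrow> real" where
  "cell u w P p = quad (P p) (P (p + u)) (P (p + u + w)) (P (p + w))"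

lemma abs_cross_le: "\<bar>cross a b\<bar> \<le> cmod a * cmod b"
  unfolding cross_def by (metis abs_Im_le_cmod complex_mod_cnj norm_mult)

lemma abs_quad_le:
  assumes "dist a c \<le> r" "dist b d \<le> s"
  shows "\<bar>quad a b c d\<bar> \<le> r * s"
proof -
  have "\<bar>quad a b c d\<bar> \<le> dist a c * dist b d"
    unfolding quad_def using abs_cross_le[of "c - a" "d - b"] by (simp add: dist_norm norm_minus_commute)
  also have "\<dots> \<le> r * s" using assms by (intro mult_mono) (auto intro: order.trans[OF zero_le_dist])
  finally show ?thesis .
qed

text \<open>The shoelace formula. Two of the edges are written against the orientation, so that the
  terms of neighbouring cells telescope over a grid.\<close>

lemma quad_edges: "quad a b c d = cross a b + cross b c - cross d c - cross a d"
  by (simp add: quad_def cross_def algebra_simps)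

text \<open>The surface of a box is closed: top minus bottom equals the signed sum of the four
  lateral faces.\<close>

lemma quad_homotopy:
  "quad a b c d - quad a' b' c' d' = quad a b b' a' + quad b c c' b' - quad d c c' d' - quad a d d' a'"
  by (simp add: quad_def cross_def algebra_simps)

text \<open>Grid maps live on the whole of Z^2, so shifts never leave the domain; only the sums are
  restricted to \<open>grid n\<close>.\<close>

definition step_lipschitz :: "real \<Rightarrow> (int \<times> int \<Rightarrow> 'b::metric_space) \<Rightarrow> bool" where
  "step_lipschitz L F \<longleftrightarrow>
     (\<forall>p. dist (F p) (F (p + (1, 0))) \<le> L \<and> dist (F p) (F (p + (0, 1))) \<le> L)"

lemma step_chain:
  fixes f :: "int \<Rightarrow> 'b::metric_space"
  assumes "\<And>i. dist (f i) (f (i + 1)) \<le> L"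
  shows "dist (f i) (f (i + k)) \<le> L * \<bar>k\<bar>"
proof -
  have nat: "dist (f i) (f (i + int k)) \<le> L * k" for i k
  proof (induction k)
    case (Suc k)
    have "dist (f i) (f (i + int (Suc k))) \<le> dist (f i) (f (i + int k)) + dist (f (i + int k)) (f (i + int k + 1))"
      by (metis add.assoc add.commute dist_triangle of_nat_Suc)
    then show ?case using Suc assms[of "i + int k"] by (simp add: algebra_simps)
  qed simp
  show ?thesis
  proof (cases "k \<ge> 0")
    case True
    then show ?thesis using nat[of i "nat k"] by simp
  next
    case False
    then show ?thesis using nat[of "i + k" "nat (- k)"] by (simp add: dist_commute)
  qed
qed

lemma step_lipschitzD:
  assumes "step_lipschitz L F"
  shows "dist (F p) (F (p + v)) \<le> L * size1 v"
proof -
  obtain i j a b where pv: "p = (i, j)" "v = (a, b)" by (cases p, cases v)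
  have "dist (F (i, j)) (F (i + a, j)) \<le> L * \<bar>a\<bar>"
    by (rule step_chain) (use assms in \<open>force simp: step_lipschitz_def\<close>)
  moreover have "dist (F (i + a, j)) (F (i + a, j + b)) \<le> L * \<bar>b\<bar>"
    by (rule step_chain) (use assms in \<open>force simp: step_lipschitz_def\<close>)
  ultimately show ?thesis
    using dist_triangle[of "F (i, j)" "F (i + a, j + b)" "F (i + a, j)"]
    by (simp add: pv size1_def algebra_simps)
qed

text \<open>Each cell spans a box between \<open>P\<close> and \<open>P'\<close>. A lateral face
  shared by two neighbouring boxes cancels, so only faces over the border of the grid remain. There
  are four rows of n of them, and each is at most (L + r)^2 because both of its diagonals are at
  most L + r.\<close>

lemma sum_cell_homotopy:
  fixes P P' :: "int \<times> int \<Rightarrow> complex"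
  assumes P: "step_lipschitz L P" and P': "step_lipschitz L P'"
    and r: "\<And>p. dist (P p) (P' p) \<le> r"
  shows "\<bar>(\<Sum>p\<in>grid n. cell (1,0) (0,1) P p) - (\<Sum>p\<in>grid n. cell (1,0) (0,1) P' p)\<bar>
    \<le> 4 * (L + r)\<^sup>2 * n"
proof -
  \<comment> \<open>\<open>Q e p\<close> is the lateral face over the edge from \<open>p\<close> to
    \<open>p + e\<close>.\<close>
  define Q where "Q e p = quad (P p) (P (p + e)) (P' (p + e)) (P' p)" for e p
  have bd: "\<bar>Q e p\<bar> \<le> (L + r)\<^sup>2" if "e = (1,0) \<or> e = (0,1)" for e p
  proof -
    have "dist (P p) (P (p + e)) \<le> L" using P that unfolding step_lipschitz_def by blast
    then have "dist (P p) (P' (p + e)) \<le> L + r"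
      using r[of "p + e"] dist_triangle[of "P p" "P' (p + e)" "P (p + e)"] by linarith
    moreover have "dist (P' p) (P' (p + e)) \<le> L" using P' that unfolding step_lipschitz_def by blast
    then have "dist (P (p + e)) (P' p) \<le> L + r"
      using r[of "p + e"] dist_triangle[of "P (p + e)" "P' p" "P' (p + e)"] by (simp add: dist_commute)
    ultimately show ?thesis unfolding Q_def power2_eq_square by (rule abs_quad_le)
  qed
  have eq: "cell (1,0) (0,1) P p - cell (1,0) (0,1) P' p
      = Q (1,0) p + Q (0,1) (p + (1,0)) - Q (1,0) (p + (0,1)) - Q (0,1) p" for p
    unfolding cell_def Q_def
    using quad_homotopy[of "P p" "P (p + (1,0))" "P (p + (1,0) + (0,1))" "P (p + (0,1))"
        "P' p" "P' (p + (1,0))" "P' (p + (1,0) + (0,1))" "P' (p + (0,1))"]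
    by (simp add: add_ac)
  have "(\<Sum>p\<in>grid n. cell (1,0) (0,1) P p) - (\<Sum>p\<in>grid n. cell (1,0) (0,1) P' p)
     = ((\<Sum>p\<in>grid n. Q (0,1) (p + (1,0))) - (\<Sum>p\<in>grid n. Q (0,1) p))
      - ((\<Sum>p\<in>grid n. Q (1,0) (p + (0,1))) - (\<Sum>p\<in>grid n. Q (1,0) p))"
    unfolding sum_subtractf[symmetric] by (rule sum.cong) (simp_all add: eq)
  moreover have "\<bar>(\<Sum>p\<in>grid n. Q (0,1) (p + (1,0))) - (\<Sum>p\<in>grid n. Q (0,1) p)\<bar> \<le> 2 * (L + r)\<^sup>2 * n"
    using sum_grid_shift[of "Q (0,1)" "(L + r)\<^sup>2" "(1,0)" n] bd by (simp add: size1_def)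
  moreover have "\<bar>(\<Sum>p\<in>grid n. Q (1,0) (p + (0,1))) - (\<Sum>p\<in>grid n. Q (1,0) p)\<bar> \<le> 2 * (L + r)\<^sup>2 * n"
    using sum_grid_shift[of "Q (1,0)" "(L + r)\<^sup>2" "(0,1)" n] bd by (simp add: size1_def)
  ultimately show ?thesis by linarith
qed

section \<open>Areas of coarse cells\<close>

definition nmult :: "nat \<Rightarrow> int \<times> int \<Rightarrow> int \<times> int" where
  "nmult k u = (int k * fst u, int k * snd u)"

lemma nmult_Suc: "nmult (Suc k) u = nmult k u + u"
  by (cases u) (simp add: nmult_def algebra_simps)

lemma abs_cell_le:
  assumes "step_lipschitz L P"
  shows "\<bar>cell u w P p\<bar> \<le> (L * size1 (u + w)) * (L * size1 (w - u))"
  unfolding cell_def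
  using step_lipschitzD[OF assms, of p "u + w"] step_lipschitzD[OF assms, of "p + u" "w - u"]
  by (intro abs_quad_le) (simp_all add: add.assoc)

lemma cell_swap: "cell u w P p = - cell w u P p"
  by (simp add: cell_def quad_def cross_def algebra_simps)

text \<open>A parallelogram with side u + v is cut into two. The image of the cutting corner need
  not lie on the straight edge, which is corrected by the triangle \<open>t\<close> (a quadrilateral
  with a repeated vertex) at one edge and by its translate at the opposite edge. In sums over the
  grid the two corrections cancel up to a linear term.\<close>

lemma cell_add:
  fixes P :: "int \<times> int \<Rightarrow> complex"
  defines "t \<equiv> \<lambda>u v p. quad (P p) (P (p + u)) (P (p + u + v)) (P (p + u + v))"
  shows "cell (u + v) w P p = cell u w P p + cell v w P (p + u) - t u v p + t u v (p + w)"
  by (simp add: cell_def quad_def cross_def t_def algebra_simps)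

text \<open>Induction on k by \<open>cell_add\<close>, where every correction is a difference of
  shifted sums. The constant is uniform in \<open>P\<close> and \<open>n\<close>, as needed when
  \<open>n\<close> tends to infinity with k fixed.\<close>

lemma sum_cell_nmult:
  "\<exists>C::real. \<forall>P n. step_lipschitz L P \<longrightarrow>
     \<bar>(\<Sum>p\<in>grid n. cell (nmult k u) w P p) - k * (\<Sum>p\<in>grid n. cell u w P p)\<bar> \<le> C * n"
proof (induction k)
  case 0
  have "cell 0 w P p = 0" for P p
    by (simp add: cell_def quad_def cross_def algebra_simps)
  then show ?case by (intro exI[of _ 0]) (simp add: nmult_def zero_prod_def[symmetric])
next
  case (Suc k)
  then obtain C :: real where C: "\<And>P n. step_lipschitz L P \<Longrightarrow>
     \<bar>(\<Sum>p\<in>grid n. cell (nmult k u) w P p) - k * (\<Sum>p\<in>grid n. cell u w P p)\<bar> \<le> C * n"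
    by blast
  define B where "B = (L * size1 (u + w)) * (L * size1 (w - u))"
  define B' where "B' = (L * size1 (nmult k u + u)) * (L * size1 u)"
  show ?case
  proof (intro exI allI impI)
    fix P :: "int \<times> int \<Rightarrow> complex" and n
    assume P: "step_lipschitz L P"
    define t where "t p = quad (P p) (P (p + nmult k u)) (P (p + nmult k u + u)) (P (p + nmult k u + u))" for p
    have t: "\<bar>t p\<bar> \<le> B'" for p
      unfolding t_def B'_def
      using step_lipschitzD[OF P, of p "nmult k u + u"] step_lipschitzD[OF P, of "p + nmult k u" u]
      by (intro abs_quad_le) (simp_all add: add.assoc)
    have "(\<Sum>p\<in>grid n. cell (nmult (Suc k) u) w P p) - Suc k * (\<Sum>p\<in>grid n. cell u w P p)
      = ((\<Sum>p\<in>grid n. cell (nmult k u) w P p) - k * (\<Sum>p\<in>grid n. cell u w P p))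
      + ((\<Sum>p\<in>grid n. cell u w P (p + nmult k u)) - (\<Sum>p\<in>grid n. cell u w P p))
      + ((\<Sum>p\<in>grid n. t (p + w)) - (\<Sum>p\<in>grid n. t p))"
      unfolding nmult_Suc cell_add t_def sum.distrib sum_subtractf by (simp add: algebra_simps)
    moreover have "\<bar>(\<Sum>p\<in>grid n. cell u w P (p + nmult k u)) - (\<Sum>p\<in>grid n. cell u w P p)\<bar>
       \<le> 2 * B * n * size1 (nmult k u)"
      unfolding B_def by (intro sum_grid_shift abs_cell_le P)
    moreover have "\<bar>(\<Sum>p\<in>grid n. t (p + w)) - (\<Sum>p\<in>grid n. t p)\<bar> \<le> 2 * B' * n * size1 w"
      by (intro sum_grid_shift t)
    ultimately show "\<bar>(\<Sum>p\<in>grid n. cell (nmult (Suc k) u) w P p) - Suc k * (\<Sum>p\<in>grid n. cell u w P p)\<bar>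
       \<le> (C + 2 * B * size1 (nmult k u) + 2 * B' * size1 w) * n"
      using C[OF P, of n] by (simp add: algebra_simps)
  qed
qed

text \<open>One side is enlarged at a time; antisymmetry (\<open>cell_swap\<close>) reduces the
  second side to the first.\<close>

lemma sum_square_cell:
  "\<exists>C::real. \<forall>P n. step_lipschitz L P \<longrightarrow>
     \<bar>(\<Sum>p\<in>grid n. cell (int k, 0) (0, int k) P p) - (real k)\<^sup>2 * (\<Sum>p\<in>grid n. cell (1, 0) (0, 1) P p)\<bar> \<le> C * n"
proof -
  obtain C :: real where C: "\<And>P n. step_lipschitz L P \<Longrightarrow>
     \<bar>(\<Sum>p\<in>grid n. cell (int k, 0) (0, int k) P p) - k * (\<Sum>p\<in>grid n. cell (1, 0) (0, int k) P p)\<bar> \<le> C * n"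
    using sum_cell_nmult[of L k "(1, 0)" "(0, int k)"] by (auto simp: nmult_def)
  obtain D :: real where D: "\<And>P n. step_lipschitz L P \<Longrightarrow>
     \<bar>(\<Sum>p\<in>grid n. cell (0, int k) (1, 0) P p) - k * (\<Sum>p\<in>grid n. cell (0, 1) (1, 0) P p)\<bar> \<le> D * n"
    using sum_cell_nmult[of L k "(0, 1)" "(1, 0)"] by (auto simp: nmult_def)
  show ?thesis
  proof (intro exI allI impI)
    fix P :: "int \<times> int \<Rightarrow> complex" and n
    assume P: "step_lipschitz L P"
    let ?X = "\<Sum>p\<in>grid n. cell (int k, 0) (0, int k) P p"
    let ?Y = "\<Sum>p\<in>grid n. cell (1, 0) (0, int k) P p"
    let ?Z = "\<Sum>p\<in>grid n. cell (1, 0) (0, 1) P p"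
    have 1: "\<bar>?X - k * ?Y\<bar> \<le> C * n" by (rule C[OF P])
    have "\<bar>- ?Y - k * (- ?Z)\<bar> \<le> D * n"
      using D[OF P, of n] unfolding cell_swap[of "(0, _)"] sum_negf .
    then have "\<bar>k * (?Y - k * ?Z)\<bar> \<le> k * (D * n)"
      unfolding abs_mult by (simp add: mult_left_mono)
    then have "\<bar>?X - (real k)\<^sup>2 * ?Z\<bar> \<le> C * n + k * (D * n)"
      using 1 by (simp add: algebra_simps power2_eq_square abs_le_iff)
    then show "\<bar>?X - (real k)\<^sup>2 * ?Z\<bar> \<le> (C + k * D) * n" by (simp add: algebra_simps)
  qed
qed

section \<open>Energies, defects and midpoint smoothing\<close>

definition energy :: "nat \<Rightarrow> int \<times> int \<Rightarrow> (int \<times> int \<Rightarrow> 'b::metric_space) \<Rightarrow> real" where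
  "energy n v F = (\<Sum>p\<in>grid n. (dist (F p) (F (p + v)))\<^sup>2)"

text \<open>By the triangle inequality and convexity of the square this is nonnegative, and it
  vanishes exactly when F(p + v) is a metric midpoint of F(p) and F(p + 2v).\<close>

definition defect :: "int \<times> int \<Rightarrow> (int \<times> int \<Rightarrow> 'b::metric_space) \<Rightarrow> int \<times> int \<Rightarrow> real" where
  "defect v F p = ((dist (F p) (F (p + v)))\<^sup>2 + (dist (F (p + v)) (F (p + v + v)))\<^sup>2) / 2
     - (dist (F p) (F (p + v + v)))\<^sup>2 / 4"

lemma defect_nonneg: "0 \<le> defect v F p"
proof -
  let ?a = "dist (F p) (F (p + v))" and ?b = "dist (F (p + v)) (F (p + v + v))"
  have "(dist (F p) (F (p + v + v)))\<^sup>2 \<le> (?a + ?b)\<^sup>2"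
    by (intro power_mono dist_triangle) auto
  also have "\<dots> \<le> 2 * (?a\<^sup>2 + ?b\<^sup>2)"
    using sum_squares_bound[of ?a ?b] by (simp add: power2_sum)
  finally show ?thesis by (simp add: defect_def)
qed

lemma dist_sq_le:
  assumes "step_lipschitz L F"
  shows "(dist (F p) (F (p + v)))\<^sup>2 \<le> (L * size1 v)\<^sup>2"
  by (intro power_mono step_lipschitzD assms) auto

lemma defect_le:
  assumes "step_lipschitz L F"
  shows "defect v F p \<le> (L * size1 v)\<^sup>2"
proof -
  have "(a + b) / 2 - c / 4 \<le> r" if "a \<le> r" "b \<le> r" "0 \<le> c" for a b c r :: real
    using that by argo
  then show ?thesis unfolding defect_def by (simp add: dist_sq_le[OF assms])
qed

lemma energy_nonneg: "0 \<le> energy n v F"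
  by (auto simp: energy_def intro: sum_nonneg)

lemma energy_le:
  assumes "step_lipschitz L F"
  shows "energy n v F \<le> (real n)\<^sup>2 * (L * size1 v)\<^sup>2"
  using sum_mono[where K = "grid n", OF dist_sq_le[OF assms, where v = v]]
  by (simp add: energy_def card_grid power2_eq_square)

text \<open>This collects what smoothing needs of a bicombing at the parameter 1/2.\<close>

definition is_midpoint_map :: "('b::metric_space \<Rightarrow> 'b \<Rightarrow> 'b) \<Rightarrow> bool" where
  "is_midpoint_map m \<longleftrightarrow> (\<forall>x y. m x y = m y x \<and> dist x (m x y) = dist x y / 2) \<and>
     (\<forall>x y x' y'. dist (m x y) (m x' y') \<le> (dist x x' + dist y y') / 2)"

definition smooth :: "('b \<Rightarrow> 'b \<Rightarrow> 'b) \<Rightarrow> int \<times> int \<Rightarrow> (int \<times> int \<Rightarrow> 'b) \<Rightarrow> int \<times> int \<Rightarrow> 'b" where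
  "smooth m v F p = m (F p) (F (p + v))"

context
  fixes m :: "'b::metric_space \<Rightarrow> 'b \<Rightarrow> 'b" and L :: real and F :: "int \<times> int \<Rightarrow> 'b"
  assumes m: "is_midpoint_map m" and F: "step_lipschitz L F"
begin

lemma dist_smooth_le:
  "dist (smooth m v F p) (smooth m v F (p + w))
    \<le> (dist (F p) (F (p + w)) + dist (F (p + v)) (F (p + v + w))) / 2"
  using m by (simp add: is_midpoint_map_def smooth_def add.assoc add.commute[of v])

lemma step_lipschitz_smooth: "step_lipschitz L (smooth m v F)"
  unfolding step_lipschitz_def
proof (intro allI conjI)
  fix p
  have *: "dist (F q) (F (q + w)) \<le> L" if "w = (1, 0) \<or> w = (0, 1)" for q w
    using F that unfolding step_lipschitz_def by blast
  show "dist (smooth m v F p) (smooth m v F (p + (1, 0))) \<le> L"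
    using dist_smooth_le[of v p "(1, 0)"] *[of "(1,0)" p] *[of "(1,0)" "p + v"] by simp
  show "dist (smooth m v F p) (smooth m v F (p + (0, 1))) \<le> L"
    using dist_smooth_le[of v p "(0, 1)"] *[of "(0,1)" p] *[of "(0,1)" "p + v"] by simp
qed

lemma dist_smooth: "dist (F p) (smooth m v F p) \<le> L * size1 v / 2"
  using m step_lipschitzD[OF F, of p v] by (simp add: is_midpoint_map_def smooth_def)

text \<open>Consecutive midpoints share the endpoint F(p + v). After exchanging the arguments of one
  of them, the conical inequality bounds their distance by half of d(F(p), F(p + 2v)).\<close>

lemma energy_smooth_same:
  "energy n v (smooth m v F) \<le> (\<Sum>p\<in>grid n. (dist (F p) (F (p + v + v)))\<^sup>2) / 4"
  unfolding energy_def sum_divide_distrib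
proof (rule sum_mono)
  fix p
  have "dist (smooth m v F p) (smooth m v F (p + v)) = dist (m (F (p + v)) (F p)) (m (F (p + v)) (F (p + v + v)))"
    using m by (simp add: is_midpoint_map_def smooth_def)
  also have "\<dots> \<le> dist (F p) (F (p + v + v)) / 2"
    using m unfolding is_midpoint_map_def by (metis add.left_neutral dist_self)
  finally have "(dist (smooth m v F p) (smooth m v F (p + v)))\<^sup>2 \<le> (dist (F p) (F (p + v + v)) / 2)\<^sup>2"
    by (intro power_mono) auto
  then show "(dist (smooth m v F p) (smooth m v F (p + v)))\<^sup>2 \<le> (dist (F p) (F (p + v + v)))\<^sup>2 / 4"
    by (simp add: power_divide)
qed

lemma energy_shift:
  "\<bar>(\<Sum>p\<in>grid n. (dist (F (p + v)) (F (p + v + w)))\<^sup>2) - energy n w F\<bar> \<le> 2 * (L * size1 w)\<^sup>2 * n * size1 v"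
  using sum_grid_shift[of "\<lambda>p. (dist (F p) (F (p + w)))\<^sup>2" "(L * size1 w)\<^sup>2" v n] dist_sq_le[OF F]
  by (simp add: energy_def)

text \<open>By convexity the new energy is at most the mean of the old energy and its translate by
  v; the translation costs a linear term.\<close>

lemma energy_smooth:
  "energy n w (smooth m v F) \<le> energy n w F + (L * size1 w)\<^sup>2 * size1 v * n"
proof -
  have "energy n w (smooth m v F) \<le>
      (\<Sum>p\<in>grid n. ((dist (F p) (F (p + w)))\<^sup>2 + (dist (F (p + v)) (F (p + v + w)))\<^sup>2) / 2)"
    unfolding energy_def
  proof (rule sum_mono)
    fix p
    let ?a = "dist (F p) (F (p + w))" and ?b = "dist (F (p + v)) (F (p + v + w))"
    have "(dist (smooth m v F p) (smooth m v F (p + w)))\<^sup>2 \<le> ((?a + ?b) / 2)\<^sup>2"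
      by (intro power_mono dist_smooth_le) auto
    also have "\<dots> \<le> (?a\<^sup>2 + ?b\<^sup>2) / 2"
      using sum_squares_bound[of ?a ?b] by (simp add: power2_sum power_divide)
    finally show "(dist (smooth m v F p) (smooth m v F (p + w)))\<^sup>2 \<le> (?a\<^sup>2 + ?b\<^sup>2) / 2" .
  qed
  also have "\<dots> = (energy n w F + (\<Sum>p\<in>grid n. (dist (F (p + v)) (F (p + v + w)))\<^sup>2)) / 2"
    by (simp add: energy_def sum.distrib sum_divide_distrib[symmetric])
  finally show ?thesis using energy_shift[where n = n and v = v and w = w] by (simp add: algebra_simps)
qed

text \<open>Up to a shift, the defects sum to the energy in direction v minus a quarter of the
  energy in direction 2v. By \<open>energy_smooth_same\<close> that quarter is at least the energy
  after smoothing, so the energy drop controls the defects.\<close>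

lemma sum_defect_le:
  "(\<Sum>p\<in>grid n. defect v F p) \<le> energy n v F - energy n v (smooth m v F) + (L * size1 v)\<^sup>2 * size1 v * n"
proof -
  have "(\<Sum>p\<in>grid n. defect v F p) = (energy n v F + (\<Sum>p\<in>grid n. (dist (F (p + v)) (F (p + v + v)))\<^sup>2)) / 2
     - (\<Sum>p\<in>grid n. (dist (F p) (F (p + v + v)))\<^sup>2) / 4"
    by (simp add: defect_def energy_def sum.distrib sum_subtractf sum_divide_distrib[symmetric])
  then show ?thesis
    using energy_shift[where n = n and v = v and w = v] energy_smooth_same[where n = n and v = v] by (simp add: algebra_simps)
qed

end

section \<open>Almost minimisers\<close>

definition circ :: "nat \<Rightarrow> (int \<times> int \<Rightarrow> complex) \<Rightarrow> real" where
  "circ n P = (\<Sum>p\<in>grid n. cell (1, 0) (0, 1) P p)"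

definition penalized_energy ::
  "(int \<times> int) set \<Rightarrow> real \<Rightarrow> nat \<Rightarrow> ('b::metric_space \<Rightarrow> complex) \<Rightarrow> (int \<times> int \<Rightarrow> 'b) \<Rightarrow> real" where
  "penalized_energy V M n \<phi> F = (\<Sum>v\<in>V. energy n v F) - M * circ n (\<phi> \<circ> F)"

context
  fixes \<phi> :: "'b::metric_space \<Rightarrow> complex"
  assumes chi: "\<And>x y. dist (\<phi> x) (\<phi> y) \<le> 2 * dist x y"
begin

lemma step_lipschitz_chart: "step_lipschitz L F \<Longrightarrow> step_lipschitz (2 * L) (\<phi> \<circ> F)"
  unfolding step_lipschitz_def comp_def
  by (meson chi mult_left_mono order.trans zero_le_numeral)

text \<open>The chart doubles the step bound and both diagonals of a unit cell have
  \<open>size1\<close> equal to 2, which gives (4 L)^2 per cell.\<close>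

lemma circ_le:
  assumes "step_lipschitz L F"
  shows "circ n (\<phi> \<circ> F) \<le> 16 * L\<^sup>2 * (real n)\<^sup>2"
proof -
  have "circ n (\<phi> \<circ> F) \<le> (\<Sum>p\<in>grid n. 16 * L\<^sup>2)"
    unfolding circ_def
  proof (rule sum_mono)
    fix p
    show "cell (1, 0) (0, 1) (\<phi> \<circ> F) p \<le> 16 * L\<^sup>2"
      using abs_cell_le[OF step_lipschitz_chart[OF assms], of "(1,0)" "(0,1)" p]
      by (simp add: size1_def power2_eq_square)
  qed
  then show ?thesis by (simp add: card_grid power2_eq_square mult_ac)
qed

lemma circ_smooth:
  fixes m :: "'b \<Rightarrow> 'b \<Rightarrow> 'b"
  assumes m: "is_midpoint_map m" and F: "step_lipschitz L F"
  shows "\<bar>circ n (\<phi> \<circ> F) - circ n (\<phi> \<circ> smooth m v F)\<bar> \<le> 4 * (2 * L + L * size1 v)\<^sup>2 * n"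
  unfolding circ_def
proof (rule sum_cell_homotopy)
  show "dist ((\<phi> \<circ> F) p) ((\<phi> \<circ> smooth m v F) p) \<le> L * size1 v" for p
    using chi[of "F p" "smooth m v F p"] dist_smooth[OF m F, of p v] by simp
qed (intro step_lipschitz_chart step_lipschitz_smooth m F)+

text \<open>Smoothing in direction v is an admissible competitor. It raises the other energies and
  changes the area only by linear terms, so the energy in direction v can drop only linearly as
  well, and this drop controls the defects. Hence the average defect is of order 1/n.\<close>

lemma sum_defect_near_minimizer:
  fixes m :: "'b \<Rightarrow> 'b \<Rightarrow> 'b"
  assumes m: "is_midpoint_map m" and F: "step_lipschitz L F"
    and min: "\<And>F'. step_lipschitz L F' \<Longrightarrow> penalized_energy V M n \<phi> F \<le> penalized_energy V M n \<phi> F' + 1"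
    and V: "finite V" "v \<in> V" and M: "M \<ge> 0" and n: "n \<ge> 1"
  shows "(\<Sum>p\<in>grid n. defect v F p) \<le>
     ((\<Sum>w\<in>V. (L * size1 w)\<^sup>2 * size1 v) + 4 * M * (2 * L + L * size1 v)\<^sup>2 + 1) * n"
proof -
  let ?S = "smooth m v F"
  let ?V = "V - {v}"
  have split: "(\<Sum>w\<in>V. f w) = f v + (\<Sum>w\<in>?V. f w)" for f :: "_ \<Rightarrow> real"
    using V by (simp add: sum.remove)
  have "penalized_energy V M n \<phi> F \<le> penalized_energy V M n \<phi> ?S + 1"
    by (intro min step_lipschitz_smooth m F)
  then have 1: "energy n v F - energy n v ?S
     \<le> (\<Sum>w\<in>?V. energy n w ?S) - (\<Sum>w\<in>?V. energy n w F) + M * (circ n (\<phi> \<circ> F) - circ n (\<phi> \<circ> ?S)) + 1"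
    unfolding penalized_energy_def split by (simp add: algebra_simps)
  have "(\<Sum>w\<in>?V. energy n w ?S) \<le> (\<Sum>w\<in>?V. energy n w F + (L * size1 w)\<^sup>2 * size1 v * n)"
    by (intro sum_mono energy_smooth m F)
  then have 2: "(\<Sum>w\<in>?V. energy n w ?S) - (\<Sum>w\<in>?V. energy n w F)
       \<le> (\<Sum>w\<in>?V. (L * size1 w)\<^sup>2 * size1 v) * n"
    by (simp add: sum.distrib sum_distrib_right)
  have 3: "M * (circ n (\<phi> \<circ> F) - circ n (\<phi> \<circ> ?S)) \<le> M * (4 * (2 * L + L * size1 v)\<^sup>2 * n)"
    using circ_smooth[OF m F, of n v] M by (intro mult_left_mono) auto
  have "(\<Sum>p\<in>grid n. defect v F p) \<le> energy n v F - energy n v ?S + (L * size1 v)\<^sup>2 * size1 v * n"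
    by (rule sum_defect_le[OF m F])
  also have "\<dots> \<le> (\<Sum>w\<in>?V. (L * size1 w)\<^sup>2 * size1 v) * n + M * (4 * (2 * L + L * size1 v)\<^sup>2 * n) + 1 * n
      + (L * size1 v)\<^sup>2 * size1 v * n"
    using 1 2 3 n by linarith
  also have "\<dots> = ((\<Sum>w\<in>V. (L * size1 w)\<^sup>2 * size1 v) + 4 * M * (2 * L + L * size1 v)\<^sup>2 + 1) * n"
    unfolding split[of "\<lambda>w. (L * size1 w)\<^sup>2 * size1 v"] by (simp add: algebra_simps)
  finally show ?thesis .
qed

text \<open>The infimum is finite by \<open>circ_le\<close> but need not be attained. A slack of 1
  is harmless beside linear errors.\<close>

lemma near_minimizer_exists:
  fixes F0 :: "int \<times> int \<Rightarrow> 'b"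
  assumes F0: "step_lipschitz L F0" and V: "finite V" and M: "M \<ge> 0"
  obtains F where "step_lipschitz L F"
    "\<And>F'. step_lipschitz L F' \<Longrightarrow> penalized_energy V M n \<phi> F \<le> penalized_energy V M n \<phi> F' + 1"
proof -
  let ?A = "penalized_energy V M n \<phi> ` {F. step_lipschitz L F}"
  have "bdd_below ?A"
  proof (intro bdd_belowI2)
    fix F :: "int \<times> int \<Rightarrow> 'b" assume "F \<in> {F. step_lipschitz L F}"
    then have "M * circ n (\<phi> \<circ> F) \<le> M * (16 * L\<^sup>2 * (real n)\<^sup>2)"
      using M by (intro mult_left_mono circ_le) auto
    moreover have "(\<Sum>v\<in>V. energy n v F) \<ge> 0"
      by (intro sum_nonneg energy_nonneg)
    ultimately show "- M * (16 * L\<^sup>2 * (real n)\<^sup>2) \<le> penalized_energy V M n \<phi> F"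
      unfolding penalized_energy_def mult_minus_left by linarith
  qed
  moreover have "?A \<noteq> {}" using F0 by auto
  ultimately obtain a where "a \<in> ?A" "a < Inf ?A + 1"
    using cInf_lessD[of ?A "Inf ?A + 1"] by auto
  then obtain F where F: "step_lipschitz L F" "penalized_energy V M n \<phi> F < Inf ?A + 1" by auto
  show ?thesis
  proof (rule that[OF F(1)])
    fix F' :: "int \<times> int \<Rightarrow> 'b" assume "step_lipschitz L F'"
    then have "Inf ?A \<le> penalized_energy V M n \<phi> F'"
      using \<open>bdd_below ?A\<close> by (intro cInf_lower) auto
    then show "penalized_energy V M n \<phi> F \<le> penalized_energy V M n \<phi> F' + 1" using F(2) by linarith
  qed
qed

end

lemma sum_grid_pos_imp:
  fixes f :: "int \<times> int \<Rightarrow> real"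
  assumes "(\<Sum>p\<in>grid n. f p) \<ge> b * (real n)\<^sup>2" "n > 0"
  obtains p where "f p \<ge> b"
proof -
  have "\<not> (\<forall>p. f p < b)"
  proof
    assume "\<forall>p. f p < b"
    moreover have "grid n \<noteq> {}" using \<open>n > 0\<close> by (auto simp: grid_def)
    ultimately have "(\<Sum>p\<in>grid n. f p) < (\<Sum>p\<in>grid n. b)"
      by (intro sum_strict_mono) auto
    then show False using assms(1) by (simp add: card_grid power2_eq_square mult_ac)
  qed
  then show ?thesis using that by (meson not_le)
qed

text \<open>Averaging over the base point p, the area of an m0 by m0 block of cells of mesh k stays
  large while the defects near p become small. The weighted difference of the two is therefore large
  at some p. The threshold \<open>n0\<close> is uniform in the chart and the initial map, so that
  these may be chosen afterwards.\<close>

proposition exists_flat_spot: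
  fixes m :: "'b::metric_space \<Rightarrow> 'b \<Rightarrow> 'b"
  assumes m: "is_midpoint_map m" and V: "finite V"
    and pos: "L > 0" "c > 0" "\<eta> > 0" "k > 0" "m0 > 0"
  shows "\<exists>n0. \<forall>n\<ge>n0. \<forall>(\<phi> :: 'b \<Rightarrow> complex) F0.
     (\<forall>x y. dist (\<phi> x) (\<phi> y) \<le> 2 * dist x y) \<and> step_lipschitz L F0 \<and> circ n (\<phi> \<circ> F0) \<ge> c * L\<^sup>2 * (real n)\<^sup>2 \<longrightarrow>
     (\<exists>F p. step_lipschitz L F \<and> (\<forall>q\<in>V. \<forall>v\<in>V. defect v F (p + q) \<le> \<eta>) \<and>
       (\<Sum>q\<in>grid m0. cell (int k, 0) (0, int k) (\<phi> \<circ> F) (p + nmult k q)) \<ge> c / 4 * (L * k * m0)\<^sup>2)"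
proof -
  \<comment> \<open>\<open>B\<close> bounds the total energy per grid point of any admissible map.
    \<open>M\<close> makes the area reward of \<open>F0\<close> twice (B + 1) n^2, so a near
    minimiser, whose energies are nonnegative, keeps at least half of the guaranteed area.
    \<open>A\<close> is the price of a defect, so high that a single excess over \<eta> would
    outweigh the area of a whole block.\<close>
  define B where "B = (\<Sum>v\<in>V. (L * size1 v)\<^sup>2)"
  define M where "M = 2 * (B + 1) / (c * L\<^sup>2)"
  define A where "A = 16 * (real m0)\<^sup>2 * L\<^sup>2 * (real k)\<^sup>2 * 4 / \<eta>"
  have B0: "B \<ge> 0" unfolding B_def by (intro sum_nonneg) auto
  have M0: "M > 0" unfolding M_def using B0 pos by (intro divide_pos_pos mult_pos_pos) auto
  have A0: "A > 0" using pos by (simp add: A_def)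
  define D where "D v = (\<Sum>w\<in>V. (L * size1 w)\<^sup>2 * size1 v) + 4 * M * (2 * L + L * size1 v)\<^sup>2 + 1" for v
  define E where "E = (\<Sum>q\<in>V. \<Sum>v\<in>V. D v + 2 * (L * size1 v)\<^sup>2 * size1 q)"
  obtain C :: real where C: "\<And>P n. step_lipschitz (2 * L) P \<Longrightarrow>
     \<bar>(\<Sum>p\<in>grid n. cell (int k, 0) (0, int k) P p) - (real k)\<^sup>2 * circ n P\<bar> \<le> C * n"
    using sum_square_cell[of "2 * L" k] unfolding circ_def by blast
  define b where "b = 16 * L\<^sup>2 * (real k)\<^sup>2"
  define G where "G = (\<Sum>q\<in>grid m0. C + 2 * b * size1 (nmult k q))"
  \<comment> \<open>Beyond \<open>n0\<close> the linear errors, \<open>G\<close> from the areas and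
    \<open>A * E\<close> from the defects, use up at most half of the main term c/2 (L k m0)^2
    n^2.\<close>
  define n0 where "n0 = nat \<lceil>(G + A * E) * 4 / (c * (L * k * m0)\<^sup>2)\<rceil> + 1"
  show ?thesis
  proof (intro exI[of _ n0] allI impI, elim conjE)
    fix n \<phi> and F0 :: "int \<times> int \<Rightarrow> 'b"
    assume n: "n0 \<le> n" and "\<forall>x y. dist (\<phi> x) (\<phi> y) \<le> 2 * dist x y"
      and F0: "step_lipschitz L F0" and circ0: "c * L\<^sup>2 * (real n)\<^sup>2 \<le> circ n (\<phi> \<circ> F0)"
    then have chi: "\<And>x y. dist (\<phi> x) (\<phi> y) \<le> 2 * dist x y" by blast
    have n1: "n \<ge> 1" using n by (simp add: n0_def)
    obtain F where F: "step_lipschitz L F" and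
      min: "\<And>F'. step_lipschitz L F' \<Longrightarrow> penalized_energy V M n \<phi> F \<le> penalized_energy V M n \<phi> F' + 1"
      using near_minimizer_exists[OF chi F0 V, of M n] M0 by auto
    let ?P = "\<phi> \<circ> F"
    have P: "step_lipschitz (2 * L) ?P" by (rule step_lipschitz_chart[OF chi F])
    have "circ n ?P \<ge> c / 2 * L\<^sup>2 * (real n)\<^sup>2"
    proof -
      have "(\<Sum>v\<in>V. energy n v F0) \<le> (real n)\<^sup>2 * B"
        unfolding B_def sum_distrib_left by (intro sum_mono energy_le F0)
      moreover have "(\<Sum>v\<in>V. energy n v F) \<ge> 0" by (intro sum_nonneg energy_nonneg)
      moreover have "1 \<le> (real n)\<^sup>2" using n1 by simp
      ultimately have "M * circ n (\<phi> \<circ> F0) - (real n)\<^sup>2 * (B + 1) \<le> M * circ n ?P"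
        using min[OF F0] by (simp add: penalized_energy_def algebra_simps)
      moreover have "M * circ n (\<phi> \<circ> F0) \<ge> M * (c * L\<^sup>2 * (real n)\<^sup>2)"
        using circ0 M0 by (intro mult_left_mono) auto
      moreover have "M * (c * L\<^sup>2 * (real n)\<^sup>2) = 2 * ((real n)\<^sup>2 * (B + 1))"
        using pos by (simp add: M_def)
      moreover have "M * (c / 2 * L\<^sup>2 * (real n)\<^sup>2) = (real n)\<^sup>2 * (B + 1)"
        using pos by (simp add: M_def)
      ultimately have "M * (c / 2 * L\<^sup>2 * (real n)\<^sup>2) \<le> M * circ n ?P" by linarith
      then show ?thesis using M0 by simp
    qed
    then have "(real k)\<^sup>2 * (c / 2 * L\<^sup>2 * (real n)\<^sup>2) \<le> (real k)\<^sup>2 * circ n ?P"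
      by (intro mult_left_mono) auto
    then have cells: "(\<Sum>p\<in>grid n. cell (int k, 0) (0, int k) ?P p) \<ge> (real k)\<^sup>2 * (c / 2 * L\<^sup>2 * (real n)\<^sup>2) - C * n"
      using C[OF P, of n] by linarith
    have cell_b: "\<bar>cell (int k, 0) (0, int k) ?P p\<bar> \<le> b" for p
      using abs_cell_le[OF P, of "(int k, 0)" "(0, int k)" p]
      by (simp add: size1_def b_def power2_eq_square algebra_simps)
    define S where "S p = (\<Sum>q\<in>grid m0. cell (int k, 0) (0, int k) ?P (p + nmult k q))" for p
    define T where "T p = (\<Sum>q\<in>V. \<Sum>v\<in>V. defect v F (p + q))" for p
    have "(\<Sum>p\<in>grid n. S p) = (\<Sum>q\<in>grid m0. \<Sum>p\<in>grid n. cell (int k, 0) (0, int k) ?P (p + nmult k q))"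
      unfolding S_def by (rule sum.swap)
    also have "\<dots> \<ge> (\<Sum>q\<in>grid m0. (real k)\<^sup>2 * (c / 2 * L\<^sup>2 * (real n)\<^sup>2) - (C + 2 * b * size1 (nmult k q)) * n)"
    proof (rule sum_mono)
      fix q
      show "(real k)\<^sup>2 * (c / 2 * L\<^sup>2 * (real n)\<^sup>2) - (C + 2 * b * size1 (nmult k q)) * n
        \<le> (\<Sum>p\<in>grid n. cell (int k, 0) (0, int k) ?P (p + nmult k q))"
        using sum_grid_shift[where f = "cell (int k, 0) (0, int k) ?P" and q = "nmult k q" and n = n, OF cell_b] cells
        by (simp add: algebra_simps)
    qed
    finally have sumS: "(\<Sum>p\<in>grid n. S p) \<ge> (real m0)\<^sup>2 * ((real k)\<^sup>2 * (c / 2 * L\<^sup>2 * (real n)\<^sup>2)) - G * n"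
      unfolding sum_subtractf G_def sum_distrib_right by (simp add: card_grid power2_eq_square)
    have "(\<Sum>p\<in>grid n. T p) = (\<Sum>q\<in>V. \<Sum>v\<in>V. \<Sum>p\<in>grid n. defect v F (p + q))"
      unfolding T_def by (subst sum.swap) (intro sum.cong refl sum.swap)
    also have "\<dots> \<le> (\<Sum>q\<in>V. \<Sum>v\<in>V. (D v + 2 * (L * size1 v)\<^sup>2 * size1 q) * n)"
    proof (intro sum_mono)
      fix q v assume "q \<in> V" "v \<in> V"
      have "\<bar>defect v F p\<bar> \<le> (L * size1 v)\<^sup>2" for p
        using defect_le[OF F] defect_nonneg[of v F p] by simp
      from sum_grid_shift[where f = "defect v F", OF this, where q = q and n = n]
        sum_defect_near_minimizer[OF chi m F min V \<open>v \<in> V\<close> _ n1] M0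
      show "(\<Sum>p\<in>grid n. defect v F (p + q)) \<le> (D v + 2 * (L * size1 v)\<^sup>2 * size1 q) * n"
        unfolding D_def by (simp add: algebra_simps)
    qed
    finally have sumT: "(\<Sum>p\<in>grid n. T p) \<le> E * n"
      unfolding E_def sum_distrib_right .
    have "(G + A * E) * 4 / (c * (L * k * m0)\<^sup>2) \<le> n"
      using n unfolding n0_def by linarith
    then have "(G + A * E) \<le> c / 4 * (L * k * m0)\<^sup>2 * n"
      using pos by (simp add: pos_divide_le_eq mult_ac)
    then have "(G + A * E) * n \<le> c / 4 * (L * k * m0)\<^sup>2 * n * n"
      by (intro mult_right_mono) auto
    moreover have "A * (\<Sum>p\<in>grid n. T p) \<le> A * (E * n)"
      using sumT A0 by simp
    ultimately have "(\<Sum>p\<in>grid n. S p - A * T p) \<ge> c / 4 * (L * k * m0)\<^sup>2 * (real n)\<^sup>2"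
      using sumS unfolding sum_subtractf sum_distrib_left[symmetric]
      by (simp add: algebra_simps power2_eq_square)
    then obtain p where p: "S p - A * T p \<ge> c / 4 * (L * k * m0)\<^sup>2"
      using n1 by (elim sum_grid_pos_imp) auto
    have T0: "T p \<ge> 0" unfolding T_def by (intro sum_nonneg defect_nonneg)
    have "S p \<le> (\<Sum>q\<in>grid m0. b)"
      unfolding S_def using cell_b by (intro sum_mono) (meson abs_le_D1)
    \<comment> \<open>Each coarse cell is at most \<open>b\<close>, so the block area is at most
      m0^2 b, a quarter of A \<eta>. As the difference at p is nonnegative, the total defect there
      cannot exceed \<eta>.\<close>
    have "S p \<le> A * \<eta>"
    proof -
      have "A * \<eta> = 4 * ((real m0)\<^sup>2 * b)" using pos by (simp add: A_def b_def)
      moreover have "(real m0)\<^sup>2 * b \<ge> 0" by (simp add: b_def)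
      ultimately show ?thesis
        using \<open>S p \<le> (\<Sum>q\<in>grid m0. b)\<close> by (simp add: card_grid power2_eq_square)
    qed
    moreover have X0: "c / 4 * (L * k * m0)\<^sup>2 \<ge> 0" using pos by simp
    ultimately have "A * T p \<le> A * \<eta>"
      using p X0 by linarith
    then have "T p \<le> \<eta>" using A0 by simp
    have "defect v F (p + q) \<le> \<eta>" if "q \<in> V" "v \<in> V" for q v
    proof -
      have "defect v F (p + q) \<le> (\<Sum>v\<in>V. defect v F (p + q))"
        using V that by (intro member_le_sum) (auto intro: defect_nonneg)
      also have "\<dots> \<le> T p"
        unfolding T_def using V that
        by (intro member_le_sum[where f = "\<lambda>q. \<Sum>v\<in>V. defect v F (p + q)"]) (auto intro: defect_nonneg sum_nonneg)
      finally show ?thesis using \<open>T p \<le> \<eta>\<close> by simp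
    qed
    moreover have "S p \<ge> c / 4 * (L * k * m0)\<^sup>2"
      using p mult_nonneg_nonneg[OF less_imp_le[OF A0] T0] by linarith
    ultimately show "\<exists>F p. step_lipschitz L F \<and> (\<forall>q\<in>V. \<forall>v\<in>V. defect v F (p + q) \<le> \<eta>) \<and>
       (\<Sum>q\<in>grid m0. cell (int k, 0) (0, int k) (\<phi> \<circ> F) (p + nmult k q)) \<ge> c / 4 * (L * k * m0)\<^sup>2"
      using F unfolding S_def by blast
  qed
qed

section \<open>Fat hexagons in spaces that are not hyperbolic\<close>

definition side :: "('a \<Rightarrow> 'a \<Rightarrow> real \<Rightarrow> 'a) \<Rightarrow> 'a \<Rightarrow> 'a \<Rightarrow> 'a set" where
  "side \<sigma> x y = \<sigma> x y ` {0..1}"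

context
  fixes \<sigma> :: "'a::metric_space \<Rightarrow> 'a \<Rightarrow> real \<Rightarrow> 'a"
  assumes cb: "consistent_bicombing \<sigma>"
begin

section \<open>Combing segments\<close>

lemma bc: "bicombing \<sigma>"
  using cb by (simp add: consistent_bicombing_def)

lemma combing_0 [simp]: "\<sigma> x y 0 = x" and combing_1 [simp]: "\<sigma> x y 1 = y"
  using bc by (simp_all add: bicombing_def)

lemma dist_combing:
  "t \<in> {0..1} \<Longrightarrow> t' \<in> {0..1} \<Longrightarrow> dist (\<sigma> x y t) (\<sigma> x y t') = \<bar>t - t'\<bar> * dist x y"
  using bc unfolding bicombing_def by blast

lemma dist_combing_left: "t \<in> {0..1} \<Longrightarrow> dist x (\<sigma> x y t) = t * dist x y"
  using dist_combing[of 0 t x y] by simp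

lemma dist_combing_right: "t \<in> {0..1} \<Longrightarrow> dist (\<sigma> x y t) y = (1 - t) * dist x y"
  using dist_combing[of t 1 x y] by simp

lemma combing_rev: "t \<in> {0..1} \<Longrightarrow> \<sigma> y x t = \<sigma> x y (1 - t)"
  using bc unfolding bicombing_def by blast

lemma combing_conical:
  "t \<in> {0..1} \<Longrightarrow> dist (\<sigma> x y t) (\<sigma> x' y' t) \<le> (1 - t) * dist x x' + t * dist y y'"
  using bc unfolding bicombing_def by blast

lemma midpoint_map: "is_midpoint_map (\<lambda>x y. \<sigma> x y (1 / 2))"
  unfolding is_midpoint_map_def
proof (intro conjI allI)
  fix x y x' y'
  show "\<sigma> x y (1 / 2) = \<sigma> y x (1 / 2)" using combing_rev[of "1/2" x y] by simp
  show "dist x (\<sigma> x y (1 / 2)) = dist x y / 2" using dist_combing_left[of "1/2" x y] by simp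
  show "dist (\<sigma> x y (1 / 2)) (\<sigma> x' y' (1 / 2)) \<le> (dist x x' + dist y y') / 2"
    using combing_conical[of "1/2" x y x' y'] by (simp add: field_simps)
qed

text \<open>Consistency puts the point on the larger segment at some parameter u, and its distances
  to both ends of the subsegment determine u. If x = y, all the points coincide.\<close>

lemma combing_subsegment:
  assumes "0 \<le> r" "r \<le> s" "s \<le> 1" "t \<in> {0..1}"
  shows "\<sigma> (\<sigma> x y r) (\<sigma> x y s) t = \<sigma> x y (r + t * (s - r))"
proof -
  let ?p = "\<sigma> x y r" and ?q = "\<sigma> x y s"
  have "\<sigma> ?p ?q ` {0..1} \<subseteq> \<sigma> x y ` {0..1}"
    using cb assms by (auto simp: consistent_bicombing_def)
  then obtain u where u: "u \<in> {0..1}" "\<sigma> ?p ?q t = \<sigma> x y u" using assms(4) by blast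
  have pq: "dist ?p ?q = (s - r) * dist x y" using assms by (simp add: dist_combing)
  have 1: "\<bar>r - u\<bar> * dist x y = (t * (s - r)) * dist x y"
    using dist_combing_left[OF assms(4), of ?p ?q] dist_combing[of r u x y] u assms
    unfolding pq by auto
  have 2: "\<bar>u - s\<bar> * dist x y = ((1 - t) * (s - r)) * dist x y"
    using dist_combing_right[OF assms(4), of ?p ?q] dist_combing[of u s x y] u assms
    unfolding pq by auto
  consider "dist x y = 0" | "\<bar>r - u\<bar> = t * (s - r)" "\<bar>u - s\<bar> = (1 - t) * (s - r)"
    using 1 2 unfolding mult_right_cancel by (metis mult_right_cancel)
  then show ?thesis
  proof cases
    case 1
    have "0 \<le> t * (s - r)" using assms by simp
    moreover have "t * (s - r) \<le> 1 * (s - r)" using assms by (intro mult_right_mono) auto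
    ultimately have "r + t * (s - r) \<in> {0..1}" using assms by auto
    then have "dist x (\<sigma> x y (r + t * (s - r))) = 0" "dist x (\<sigma> x y u) = 0"
      using 1 u(1) by (simp_all only: dist_combing_left mult_zero_right)
    then show ?thesis using u(2) by simp
  next
    case 2
    then have "u = r + t * (s - r)" by (auto simp: algebra_simps abs_if split: if_splits)
    then show ?thesis using u by simp
  qed
qed

lemma side_commute: "side \<sigma> x y = side \<sigma> y x"
proof -
  have "side \<sigma> x y \<subseteq> side \<sigma> y x" for x y
  proof
    fix q assume "q \<in> side \<sigma> x y"
    then obtain t where t: "t \<in> {0..1}" "q = \<sigma> x y t" by (auto simp: side_def)
    then have "q = \<sigma> y x (1 - t)" using combing_rev[of t x y] by simp
    moreover have "1 - t \<in> {0..1}" using t by auto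
    ultimately show "q \<in> side \<sigma> y x" unfolding side_def by blast
  qed
  then show ?thesis by blast
qed

lemma left_in_side [simp]: "x \<in> side \<sigma> x y" and right_in_side [simp]: "y \<in> side \<sigma> x y"
  unfolding side_def by (force intro: rev_image_eqI[of 0] rev_image_eqI[of 1])+

lemma side_self [simp]: "side \<sigma> x x = {x}"
proof -
  have "\<sigma> x x t = x" if "t \<in> {0..1}" for t using dist_combing_left[OF that, of x x] by simp
  then show ?thesis by (force simp: side_def)
qed

lemma side_subset:
  assumes "p \<in> side \<sigma> x y" "q \<in> side \<sigma> x y"
  shows "side \<sigma> p q \<subseteq> side \<sigma> x y"
proof -
  obtain r s where rs: "r \<in> {0..1}" "s \<in> {0..1}" "p = \<sigma> x y r" "q = \<sigma> x y s"
    using assms by (auto simp: side_def)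
  have "side \<sigma> (\<sigma> x y r) (\<sigma> x y s) \<subseteq> side \<sigma> x y" if "r \<le> s" "0 \<le> r" "s \<le> 1" for r s
    using cb that by (auto simp: consistent_bicombing_def side_def)
  then show ?thesis using rs side_commute[of p q] by (cases "r \<le> s") auto
qed

lemma continuous_on_combing: "continuous_on {0..1} (\<sigma> x y)"
proof (rule lipschitz_on_continuous_on)
  show "(dist x y)-lipschitz_on {0..1} (\<sigma> x y)" 
    by (intro lipschitz_onI) (simp_all add: dist_combing dist_real_def)
qed

lemma dist_side_le:
  assumes "q \<in> side \<sigma> x y"
  shows "dist x q \<le> dist x y" "dist q y \<le> dist x y"
  using assms by (auto simp: side_def dist_combing_left dist_combing_right mult_left_le_one_le)

lemma dist_via_side:
  assumes "q \<in> side \<sigma> x y"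
  shows "dist x y = dist x q + dist q y"
  using assms by (auto simp: side_def dist_combing_left dist_combing_right algebra_simps)

text \<open>The loop is coned off from its first vertex. Radial steps have length at most (1/n)(L
  n), since the loop has n steps of length at most L, and transversal steps are bounded by
  conicality. By \<open>quad_edges\<close> the area telescopes to the boundary of the grid.\<close>

lemma cone_filling:
  fixes \<phi> :: "'a \<Rightarrow> complex"
  assumes n: "n > 0" and \<gamma>: "\<And>j. j < n \<Longrightarrow> dist (\<gamma> j) (\<gamma> (Suc j)) \<le> L" and closed: "\<gamma> n = \<gamma> 0"
  obtains F where "step_lipschitz L F"
    "circ n (\<phi> \<circ> F) = (\<Sum>j<n. cross (\<phi> (\<gamma> j)) (\<phi> (\<gamma> (Suc j))))"
proof -
  \<comment> \<open>Both parameters are clamped, so the map is defined on the whole of Z^2 and keeps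
    its step bound outside the grid.\<close>
  define \<tau> where "\<tau> i = real (min (nat i) n) / n" for i
  define \<delta> where "\<delta> j = \<gamma> (min (nat j) n)" for j
  define F where "F p = \<sigma> (\<gamma> 0) (\<delta> (snd p)) (\<tau> (fst p))" for p
  have L0: "0 \<le> L" using \<gamma>[OF n] by (meson order.trans zero_le_dist)
  have \<tau>01: "\<tau> i \<in> {0..1}" for i using n by (auto simp: \<tau>_def)
  have \<tau>_step: "\<bar>\<tau> i - \<tau> (i + 1)\<bar> \<le> 1 / n" for i
  proof -
    have "\<bar>real (min (nat i) n) - real (min (nat (i + 1)) n)\<bar> \<le> 1" by linarith
    then show ?thesis using n by (simp add: \<tau>_def diff_divide_distrib[symmetric] divide_right_mono)
  qed
  have \<delta>_step: "dist (\<delta> j) (\<delta> (j + 1)) \<le> L" for j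
  proof -
    consider "min (nat (j + 1)) n = min (nat j) n" | "nat j < n" "min (nat j) n = nat j" "min (nat (j + 1)) n = Suc (nat j)"
      by linarith
    then show ?thesis by cases (simp_all add: \<delta>_def L0 \<gamma>)
  qed
  have far: "dist (\<gamma> 0) (\<gamma> j) \<le> L * j" if "j \<le> n" for j
    using that
  proof (induction j)
    case (Suc j)
    then show ?case using \<gamma>[of j] dist_triangle[of "\<gamma> 0" "\<gamma> (Suc j)" "\<gamma> j"] by (simp add: algebra_simps)
  qed simp
  have "dist (\<gamma> 0) (\<delta> j) \<le> L * n" for j
  proof -
    have "dist (\<gamma> 0) (\<delta> j) \<le> L * (min (nat j) n)" unfolding \<delta>_def by (rule far) simp
    also have "\<dots> \<le> L * n" using L0 by (intro mult_left_mono) auto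
    finally show ?thesis .
  qed
  then have "\<bar>\<tau> i - \<tau> (i + 1)\<bar> * dist (\<gamma> 0) (\<delta> j) \<le> (1 / n) * (L * n)" for i j
    by (intro mult_mono \<tau>_step) auto
  then have 1: "dist (F p) (F (p + (1, 0))) \<le> L" for p
    using n by (simp add: F_def dist_combing[OF \<tau>01 \<tau>01])
  have "\<tau> i * dist (\<delta> j) (\<delta> (j + 1)) \<le> 1 * L" for i j
    using \<tau>01[of i] by (intro mult_mono \<delta>_step) auto
  then have 2: "dist (F p) (F (p + (0, 1))) \<le> L" for p
    using combing_conical[OF \<tau>01, of "\<gamma> 0" "\<delta> (snd p)" "fst p" "\<gamma> 0" "\<delta> (snd p + 1)"]
    by (simp add: F_def) (meson order.trans)
  let ?I = "{0..<int n}"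
  define P where "P i j = \<phi> (F (i, j))" for i j
  have "circ n (\<phi> \<circ> F) = (\<Sum>i\<in>?I. \<Sum>j\<in>?I. cell (1, 0) (0, 1) (\<phi> \<circ> F) (i, j))"
    by (simp add: circ_def grid_def sum.cartesian_product)
  also have "\<dots> = (\<Sum>i\<in>?I. \<Sum>j\<in>?I. (cross (P (i + 1) j) (P (i + 1) (j + 1)) - cross (P i j) (P i (j + 1)))
       - (cross (P i (j + 1)) (P (i + 1) (j + 1)) - cross (P i j) (P (i + 1) j)))"
    unfolding P_def by (simp add: cell_def quad_edges algebra_simps)
  also have "\<dots> = (\<Sum>j\<in>?I. \<Sum>i\<in>?I. cross (P (i + 1) j) (P (i + 1) (j + 1)) - cross (P i j) (P i (j + 1)))
     - (\<Sum>i\<in>?I. \<Sum>j\<in>?I. cross (P i (j + 1)) (P (i + 1) (j + 1)) - cross (P i j) (P (i + 1) j))"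
  proof -
    have "(\<Sum>j\<in>?I. \<Sum>i\<in>?I. f i j) = (\<Sum>i\<in>?I. \<Sum>j\<in>?I. f i j)" for f :: "int \<Rightarrow> int \<Rightarrow> real"
      by (rule sum.swap)
    from this[of "\<lambda>i j. cross (P (i + 1) j) (P (i + 1) (j + 1)) - cross (P i j) (P i (j + 1))"]
    show ?thesis by (simp only: sum_subtractf)
  qed
  also have "\<dots> = (\<Sum>j\<in>?I. cross (P (int n) j) (P (int n) (j + 1)) - cross (P 0 j) (P 0 (j + 1)))
     - (\<Sum>i\<in>?I. cross (P i (int n)) (P (i + 1) (int n)) - cross (P i 0) (P (i + 1) 0))"
  proof -
    have "(\<Sum>i\<in>?I. cross (P (i + 1) j) (P (i + 1) (j + 1)) - cross (P i j) (P i (j + 1)))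
      = cross (P (int n) j) (P (int n) (j + 1)) - cross (P 0 j) (P 0 (j + 1))" for j
      using sum_shift_Suc[where f = "\<lambda>i. cross (P i j) (P i (j + 1))" and n = n]
      by (simp add: sum_subtractf)
    moreover have "(\<Sum>j\<in>?I. cross (P i (j + 1)) (P (i + 1) (j + 1)) - cross (P i j) (P (i + 1) j))
      = cross (P i (int n)) (P (i + 1) (int n)) - cross (P i 0) (P (i + 1) 0)" for i
      using sum_shift_Suc[where f = "\<lambda>j. cross (P i j) (P (i + 1) j)" and n = n]
      by (simp add: sum_subtractf)
    ultimately show ?thesis by simp
  qed
  \<comment> \<open>The side i = 0 is constant at the apex, and the sides j = 0 and j = n agree
    because the loop is closed. Only the side i = n, the loop itself, contributes.\<close>
  also have "\<dots> = (\<Sum>j\<in>?I. cross (\<phi> (\<delta> j)) (\<phi> (\<delta> (j + 1))))"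
  proof -
    have "P 0 j = \<phi> (\<gamma> 0)" "P (int n) j = \<phi> (\<delta> j)" for j
      using n by (simp_all add: P_def F_def \<tau>_def)
    moreover have "P i (int n) = P i 0" for i
      by (simp add: P_def F_def \<delta>_def closed)
    moreover have "cross a a = 0" for a by (simp add: cross_def)
    ultimately show ?thesis by simp
  qed
  also have "\<dots> = (\<Sum>j<n. cross (\<phi> (\<delta> (int j))) (\<phi> (\<delta> (int j + 1))))"
  proof -
    have "?I = int ` {..<n}" by (simp add: image_int_atLeastLessThan flip: atLeast0LessThan)
    then show ?thesis by (simp add: sum.reindex)
  qed
  also have "\<dots> = (\<Sum>j<n. cross (\<phi> (\<gamma> j)) (\<phi> (\<gamma> (Suc j))))"
    by (intro sum.cong) (auto simp: \<delta>_def nat_add_distrib min_def)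
  finally show ?thesis using that[of F] 1 2 by (simp add: step_lipschitz_def)
qed

section \<open>Area enclosed by a fat hexagon\<close>

lemma cross_eq: "cross a b = Re a * Im b - Im a * Re b"
  by (simp add: cross_def)

text \<open>The point at parameter \<tau> of the first side is at distance at least D from the other
  five sides, so a bump function of radius D about it sees the first side only. All lengths are
  comparable to D.\<close>

definition fat_hexagon :: "real \<Rightarrow> (nat \<Rightarrow> 'a) \<Rightarrow> real \<Rightarrow> bool" where
  "fat_hexagon D a \<tau> \<longleftrightarrow> a 6 = a 0 \<and> \<tau> \<in> {0..1} \<and>
     D \<le> \<tau> * dist (a 0) (a 1) \<and> D \<le> (1 - \<tau>) * dist (a 0) (a 1) \<and>
     (\<forall>k<6. dist (a k) (a (Suc k)) \<le> 26 * D) \<and>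
     (\<forall>k. 1 \<le> k \<and> k < 6 \<longrightarrow> (\<forall>q\<in>side \<sigma> (a k) (a (Suc k)). D \<le> dist (\<sigma> (a 0) (a 1) \<tau>) q))"

text \<open>A Riemann sum of a hat of height D. The hat is at least D/2 at the indices between
  \<open>lo\<close> and \<open>hi\<close>, those with i/m within D/(2l) of \<tau>, and there are at
  least m D / l - 1 of them.\<close>

lemma sum_hat_ge:
  fixes D \<tau> l :: real and m :: nat
  assumes D: "D > 0" and l: "D \<le> \<tau> * l" "D \<le> (1 - \<tau>) * l" and \<tau>: "\<tau> \<in> {0..1}" and m: "m > 0"
  shows "(\<Sum>i<m. max 0 (D - \<bar>i / m - \<tau>\<bar> * l)) \<ge> (m * D / l - 1) * (D / 2)"
proof -
  have "D + D \<le> \<tau> * l + (1 - \<tau>) * l" using l by (rule add_mono)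
  then have l0: "l > 0" using D by (simp add: algebra_simps)
  define lo where "lo = nat \<lceil>m * (\<tau> - D / (2 * l))\<rceil>"
  define hi where "hi = nat \<lfloor>m * (\<tau> + D / (2 * l))\<rfloor>"
  have h: "D / (2 * l) > 0" "D / l \<le> \<tau>" "D / l \<le> 1 - \<tau>" "D / l = D / (2 * l) + D / (2 * l)"
    using l0 D l by (simp_all add: pos_divide_le_eq field_simps)
  have lo0: "0 \<le> m * (\<tau> - D / (2 * l))" using h by (intro mult_nonneg_nonneg) linarith+
  have "m * (\<tau> + D / (2 * l)) < m * (1::real)"
    using m h by (intro mult_strict_left_mono) linarith+
  then have "\<lfloor>m * (\<tau> + D / (2 * l))\<rfloor> < int m" unfolding floor_less_iff by simp
  then have him: "hi < m" using m unfolding hi_def by linarith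
  have hat: "D / 2 \<le> max 0 (D - \<bar>i / m - \<tau>\<bar> * l)" if "i \<in> {lo..hi}" for i
  proof -
    have "m * (\<tau> - D / (2 * l)) \<le> i" using that unfolding lo_def by simp
    then have 1: "\<tau> - D / (2 * l) \<le> i / m" using m by (simp add: pos_le_divide_eq mult.commute)
    have "0 \<le> m * (\<tau> + D / (2 * l))" using \<tau> h(1) by (intro mult_nonneg_nonneg) auto
    then have "i \<le> m * (\<tau> + D / (2 * l))" using that unfolding hi_def atLeastAtMost_iff by linarith
    then have 2: "i / m \<le> \<tau> + D / (2 * l)" using m by (simp add: pos_divide_le_eq mult.commute)
    have "\<bar>i / m - \<tau>\<bar> \<le> D / (2 * l)" using 1 2 by linarith
    then have "\<bar>i / m - \<tau>\<bar> * l \<le> D / (2 * l) * l" using l0 by (intro mult_right_mono) auto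
    also have "\<dots> = D / 2" using l0 by simp
    finally have "D / 2 \<le> D - \<bar>i / m - \<tau>\<bar> * l" by argo
    then show ?thesis by (rule max.coboundedI2)
  qed
  have "m * (\<tau> + D / (2 * l)) - m * (\<tau> - D / (2 * l)) = m * D / l"
    using l0 by (simp add: field_simps)
  moreover have "real lo < m * (\<tau> - D / (2 * l)) + 1" using lo0 unfolding lo_def by linarith
  moreover have "real hi > m * (\<tau> + D / (2 * l)) - 1" unfolding hi_def by linarith
  ultimately have "m * D / l - 1 \<le> real hi - real lo + 1" by linarith
  also have "\<dots> \<le> real (card {lo..hi})" by simp
  finally have "m * D / l - 1 \<le> real (card {lo..hi})" .
  then have "(m * D / l - 1) * (D / 2) \<le> real (card {lo..hi}) * (D / 2)"
    using D by (intro mult_right_mono) auto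
  also have "\<dots> = (\<Sum>i\<in>{lo..hi}. D / 2)" by simp
  also have "\<dots> \<le> (\<Sum>i\<in>{lo..hi}. max 0 (D - \<bar>i / m - \<tau>\<bar> * l))" by (intro sum_mono hat)
  also have "\<dots> \<le> (\<Sum>i<m. max 0 (D - \<bar>i / m - \<tau>\<bar> * l))"
    using him by (intro sum_mono2) auto
  finally show ?thesis .
qed

text \<open>Summation by parts: each summand is l/m times \<open>g i + g (Suc i)\<close> minus an
  increment of i g(i), and those increments telescope to m g(m) = 0.\<close>

lemma sum_cross_hat:
  fixes g :: "nat \<Rightarrow> real"
  assumes "g m = 0"
  shows "(\<Sum>i<m. g i * ((Suc i / m) * l) - ((i / m) * l) * g (Suc i)) = l / m * (\<Sum>i<m. g i + g (Suc i))"
proof -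
  have "(\<Sum>i<m. g i * ((Suc i / m) * l) - ((i / m) * l) * g (Suc i))
     = l / m * ((\<Sum>i<m. g i + g (Suc i)) - (\<Sum>i<m. Suc i * g (Suc i) - i * g i))"
    unfolding sum_subtractf[symmetric] sum_distrib_left
    by (intro sum.cong) (simp_all add: algebra_simps add_divide_distrib)
  also have "(\<Sum>i<m. real (Suc i) * g (Suc i) - i * g i) = 0"
    using sum_lessThan_telescope[of "\<lambda>i. i * g i" m] assms by simp
  finally show ?thesis by simp
qed

lemma fat_hexagon_filling:
  fixes k :: nat
  assumes hex: "fat_hexagon D a \<tau>" and D: "D \<ge> 2" and k: "k > 0"
  obtains n F and \<phi> :: "'a \<Rightarrow> complex" where "real n \<ge> D" "step_lipschitz (1 / k) F"
    "\<And>x y. dist (\<phi> x) (\<phi> y) \<le> 2 * dist x y"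
    "circ n (\<phi> \<circ> F) \<ge> 1 / 200000 * (1 / k)\<^sup>2 * (real n)\<^sup>2"
proof -
  let ?p = "\<sigma> (a 0) (a 1) \<tau>" and ?l = "dist (a 0) (a 1)"
  have closed: "a 6 = a 0" and \<tau>: "\<tau> \<in> {0..1}" and l: "D \<le> \<tau> * ?l" "D \<le> (1 - \<tau>) * ?l"
    and len: "\<And>j. j < 6 \<Longrightarrow> dist (a j) (a (Suc j)) \<le> 26 * D"
    and avoid: "\<And>j q. 1 \<le> j \<Longrightarrow> j < 6 \<Longrightarrow> q \<in> side \<sigma> (a j) (a (Suc j)) \<Longrightarrow> D \<le> dist ?p q"
    using hex unfolding fat_hexagon_def by blast+
  have "D + D \<le> \<tau> * ?l + (1 - \<tau>) * ?l" using l by (rule add_mono)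
  moreover have "\<tau> * ?l + (1 - \<tau>) * ?l = ?l" by (simp add: algebra_simps)
  ultimately have l0: "?l > 0" using D by linarith
  \<comment> \<open>Each side is cut into m pieces, enough for a side of length 26 D to have steps
    of at most 1/k.\<close>
  define m where "m = nat \<lceil>26 * D * k\<rceil>"
  have "0 < 26 * D * k" using D k by simp
  then have m: "26 * D * k \<le> m" "m < 26 * D * k + 1" "m > 0" unfolding m_def by linarith+
  define \<gamma> where "\<gamma> j = \<sigma> (a (j div m)) (a (Suc (j div m))) (real (j mod m) / m)" for j
  \<comment> \<open>The case i = m is included: there the quotient moves on to the next side, which
    starts at the same vertex.\<close>
  have \<gamma>: "\<gamma> (j * m + i) = \<sigma> (a j) (a (Suc j)) (i / m)" if "i \<le> m" for i j
  proof (cases "i = m")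
    case True
    have "m + m * j = Suc j * m" by simp
    then have "(m + m * j) div m = Suc j" "(m + m * j) mod m = 0" using m(3) by (metis nonzero_mult_div_cancel_right not_gr0, metis mod_mult_self2_is_0)
    then show ?thesis using m(3) True by (simp add: \<gamma>_def mult.commute add.commute)
  next
    case False
    then show ?thesis using that m(3) by (simp add: \<gamma>_def)
  qed
  have im: "i / m \<in> {0..1}" if "i \<le> m" for i :: nat using that m(3) by auto
  have step: "dist (\<gamma> j) (\<gamma> (Suc j)) \<le> 1 / k" if "j < 6 * m" for j
  proof -
    define b i where "b = j div m" and "i = j mod m"
    then have bi: "j = b * m + i" "i < m" "b < 6"
      using that m(3) by (simp_all add: less_mult_imp_div_less)
    have "dist (\<gamma> (b * m + i)) (\<gamma> (b * m + Suc i)) = \<bar>i / m - Suc i / m\<bar> * dist (a b) (a (Suc b))"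
      using bi by (simp only: \<gamma> dist_combing im less_imp_le Suc_leI)
    also have "\<dots> = dist (a b) (a (Suc b)) / m"
      by (simp add: diff_divide_distrib[symmetric])
    also have "\<dots> \<le> 26 * D / m" using len[OF \<open>b < 6\<close>] by (simp add: divide_right_mono)
    also have "\<dots> \<le> 1 / k" using m k by (simp add: field_simps)
    finally show ?thesis by (simp add: bi)
  qed
  have ends: "\<gamma> (6 * m) = \<gamma> 0" using \<gamma>[of 0 6] \<gamma>[of 0 0] closed by simp
  \<comment> \<open>The real part vanishes on the last five sides, so only the first one contributes area.\<close>
  define \<phi> where "\<phi> q = Complex (max 0 (D - dist ?p q)) (dist (a 0) q)" for q
  have phi: "dist (\<phi> x) (\<phi> y) \<le> 2 * dist x y" for x y
  proof -
    have "dist (\<phi> x) (\<phi> y) \<le> \<bar>Re (\<phi> x - \<phi> y)\<bar> + \<bar>Im (\<phi> x - \<phi> y)\<bar>"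
      unfolding dist_norm by (rule cmod_le)
    also have "\<bar>Re (\<phi> x - \<phi> y)\<bar> \<le> \<bar>dist ?p x - dist ?p y\<bar>" by (simp add: \<phi>_def)
    also have "\<dots> \<le> dist x y" using abs_dist_diff_le[of x ?p y] by (simp add: dist_commute)
    also have "\<bar>Im (\<phi> x - \<phi> y)\<bar> \<le> dist x y" using abs_dist_diff_le[of x "a 0" y] by (simp add: \<phi>_def dist_commute)
    finally show ?thesis by simp
  qed
  obtain F where F: "step_lipschitz (1 / k) F"
    "circ (6 * m) (\<phi> \<circ> F) = (\<Sum>j<6 * m. cross (\<phi> (\<gamma> j)) (\<phi> (\<gamma> (Suc j))))"
    using cone_filling[where n = "6 * m" and \<gamma> = \<gamma> and L = "1 / k" and \<phi> = \<phi>] step ends m(3) by auto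
  let ?s = "\<lambda>b i. cross (\<phi> (\<sigma> (a b) (a (Suc b)) (i / m))) (\<phi> (\<sigma> (a b) (a (Suc b)) (Suc i / m)))"
  have "circ (6 * m) (\<phi> \<circ> F) = (\<Sum>b<6. \<Sum>j\<in>{b * m..<b * m + m}. cross (\<phi> (\<gamma> j)) (\<phi> (\<gamma> (Suc j))))"
    unfolding F(2) by (rule sum.nat_group[symmetric])
  also have "\<dots> = (\<Sum>b<6. \<Sum>i<m. ?s b i)"
  proof (rule sum.cong[OF refl])
    fix b :: nat
    have "(\<Sum>j\<in>{b * m..<b * m + m}. cross (\<phi> (\<gamma> j)) (\<phi> (\<gamma> (Suc j))))
       = (\<Sum>i<m. cross (\<phi> (\<gamma> (b * m + i))) (\<phi> (\<gamma> (b * m + Suc i))))"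
      using sum.shift_bounds_nat_ivl[of "\<lambda>j. cross (\<phi> (\<gamma> j)) (\<phi> (\<gamma> (Suc j)))" 0 "b * m" m]
      by (simp add: atLeast0LessThan add.commute)
    also have "\<dots> = (\<Sum>i<m. ?s b i)"
      by (intro sum.cong refl) (simp only: \<gamma> less_imp_le Suc_leI lessThan_iff)
    finally show "(\<Sum>j\<in>{b * m..<b * m + m}. cross (\<phi> (\<gamma> j)) (\<phi> (\<gamma> (Suc j)))) = (\<Sum>i<m. ?s b i)" .
  qed
  also have "\<dots> = (\<Sum>b\<in>{0}. \<Sum>i<m. ?s b i)"
  proof (intro sum.mono_neutral_right ballI sum.neutral)
    fix b i assume "b \<in> {..<6::nat} - {0}" "i \<in> {..<m}"
    then have b: "1 \<le> b" "b < 6" and i: "i \<le> m" "Suc i \<le> m" by auto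
    have "D \<le> dist ?p (\<sigma> (a b) (a (Suc b)) (i / m))" "D \<le> dist ?p (\<sigma> (a b) (a (Suc b)) (Suc i / m))"
      by (rule avoid[OF b], unfold side_def, rule imageI[OF im], rule i)+
    then show "?s b i = 0" by (simp add: \<phi>_def cross_eq)
  qed auto
  also have "\<dots> = (\<Sum>i<m. ?s 0 i)" by simp
  \<comment> \<open>On the first side the chart traces the graph of a hat. The Riemann sum gives
    D^2/2 - (l/m) D/2, where l is at most 26 D and hence at most m; as D is at least 2, half of
    D^2/2 survives.\<close>
  also have "\<dots> \<ge> D\<^sup>2 / 4"
  proof -
    define g where "g i = max 0 (D - \<bar>real i / m - \<tau>\<bar> * ?l)" for i :: nat
    have p: "\<phi> (\<sigma> (a 0) (a (Suc 0)) (i / m)) = Complex (g i) ((i / m) * ?l)" if "i \<le> m" for i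
      using dist_combing[OF \<tau> im[OF that], of "a 0" "a 1"] dist_combing_left[OF im[OF that], of "a 0" "a 1"]
      by (simp add: \<phi>_def g_def abs_minus_commute)
    have gm: "g m = 0" using l m(3) \<tau> by (simp add: g_def)
    have "(\<Sum>i<m. ?s 0 i) = (\<Sum>i<m. g i * ((Suc i / m) * ?l) - ((i / m) * ?l) * g (Suc i))"
      by (intro sum.cong refl) (simp only: p less_imp_le Suc_leI lessThan_iff cross_eq complex.sel)
    also have "\<dots> = ?l / m * (\<Sum>i<m. g i + g (Suc i))"
      by (rule sum_cross_hat[of g m ?l, OF gm])
    also have "\<dots> \<ge> ?l / m * (\<Sum>i<m. g i)"
      by (intro mult_left_mono sum_mono) (auto simp: g_def)
    finally have 1: "(\<Sum>i<m. ?s 0 i) \<ge> ?l / m * (\<Sum>i<m. g i)" .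
    have "?l / m * ((m * D / ?l - 1) * (D / 2)) \<le> ?l / m * (\<Sum>i<m. g i)"
      using sum_hat_ge[OF _ l \<tau> m(3)] D unfolding g_def by (intro mult_left_mono) auto
    then have "?l / m * ((m * D / ?l - 1) * (D / 2)) \<le> (\<Sum>i<m. ?s 0 i)"
      using 1 by (rule order.trans)
    moreover have "?l / m * ((m * D / ?l - 1) * (D / 2)) = D\<^sup>2 / 2 - ?l / m * (D / 2)"
      using m(3) l0 by (simp add: field_simps power2_eq_square)
    moreover have "?l / m \<le> 1"
    proof -
      have "?l \<le> 26 * D * 1" using len[of 0] by simp
      also have "\<dots> \<le> 26 * D * k" using D k by (intro mult_left_mono) auto
      finally show ?thesis using m by simp
    qed
    then have "?l / m * (D / 2) \<le> 1 * (D / 2)" using D by (intro mult_right_mono) auto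
    moreover have "D / 2 \<le> D\<^sup>2 / 4" using D by (simp add: power2_eq_square)
    ultimately show ?thesis by argo
  qed
  finally have circ: "circ (6 * m) (\<phi> \<circ> F) \<ge> D\<^sup>2 / 4" .
  show ?thesis
  proof (rule that[OF _ F(1) phi])
    have "D * 1 \<le> D * (26 * k)" using k D by (intro mult_left_mono) auto
    then show "D \<le> real (6 * m)" using m by simp
    \<comment> \<open>The rounding in \<open>m\<close> costs 6, at most 3 D k. Since 159^2 = 25281
      is less than 200000/4, the area D^2/4 suffices for the constant 1/200000.\<close>
    have "real (6 * m) / k \<le> 159 * D"
    proof -
      have "real (6 * m) \<le> 156 * D * k + 6" using m by simp
      also have "6 \<le> 3 * D * k" using D k mult_mono[of 2 D 1 "real k"] by simp
      finally show ?thesis using k by (simp add: pos_divide_le_eq)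
    qed
    then have "(real (6 * m) / k)\<^sup>2 \<le> (159 * D)\<^sup>2" by (intro power_mono) auto
    then have "(real (6 * m) / k)\<^sup>2 \<le> 25281 * D\<^sup>2" by (simp add: power_mult_distrib)
    moreover have "0 \<le> D\<^sup>2" by simp
    ultimately have "1 / 200000 * (real (6 * m) / k)\<^sup>2 \<le> D\<^sup>2 / 4" by argo
    then show "1 / 200000 * (1 / k)\<^sup>2 * (real (6 * m))\<^sup>2 \<le> circ (6 * m) (\<phi> \<circ> F)"
      using circ by (simp add: power_divide)
  qed
qed

section \<open>Thin combing triangles in the sense of Rips\<close>

definition thin :: "real \<Rightarrow> bool" where
  "thin D \<longleftrightarrow> (\<forall>x y z. \<forall>p\<in>side \<sigma> x y. \<exists>q\<in>side \<sigma> z x \<union> side \<sigma> z y. dist p q \<le> D)"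

text \<open>Thinness covers the side from x to z by two closed sets, the points near one or the
  other of the remaining sides. They contain x and z respectively, so by connectedness they meet.
  The extra 1 replaces the infimum in \<open>infdist\<close> by an actual point.\<close>

lemma side_near_both:
  fixes x y z :: 'a
  assumes "thin D"
  obtains p q q' where "p \<in> side \<sigma> x z" "q \<in> side \<sigma> y x" "q' \<in> side \<sigma> y z" "dist p q \<le> D + 1" "dist p q' \<le> D + 1"
proof -
  define f where "f A t = infdist (\<sigma> x z t) A" for A t
  define T where "T A = {t\<in>{0..1}. f A t \<le> D}" for A
  have cont: "continuous_on {0..1} (f A)" for A
    unfolding f_def by (intro continuous_on_infdist continuous_on_combing)
  have closed: "closed (T A)" for A
    unfolding T_def by (intro continuous_closed_preimage_constant[where S = "{0..1}", unfolded vimage_def]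
      continuous_on_closed_Collect_le cont continuous_on_const) auto
  have D0: "D \<ge> 0"
  proof -
    obtain q where "dist x q \<le> D" using assms unfolding thin_def by (meson left_in_side)
    then show ?thesis by (meson order.trans zero_le_dist)
  qed
  have near: "\<exists>q\<in>side \<sigma> y w. dist (\<sigma> x z t) q \<le> D + 1" if "t \<in> T (side \<sigma> y w)" for w t
  proof -
    have ne: "side \<sigma> y w \<noteq> {}" using left_in_side by blast
    have "Inf {dist (\<sigma> x z t) q |q. q \<in> side \<sigma> y w} < D + 1"
      using that ne by (simp add: T_def f_def infdist_notempty setcompr_eq_image)
    then have "\<exists>r\<in>{dist (\<sigma> x z t) q |q. q \<in> side \<sigma> y w}. r < D + 1"
      using ne by (subst (asm) cInf_less_iff) (auto intro!: bdd_belowI[of _ 0])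
    then show ?thesis by force
  qed
  have "T (side \<sigma> y x) \<inter> T (side \<sigma> y z) \<noteq> {}"
  proof
    assume empty: "T (side \<sigma> y x) \<inter> T (side \<sigma> y z) = {}"
    have "{0..1} \<subseteq> T (side \<sigma> y x) \<union> T (side \<sigma> y z)"
    proof
      fix t :: real assume t: "t \<in> {0..1}"
      then have "\<sigma> x z t \<in> side \<sigma> x z" by (simp add: side_def)
      then obtain q where "q \<in> side \<sigma> y x \<union> side \<sigma> y z" "dist (\<sigma> x z t) q \<le> D"
        using assms unfolding thin_def by meson
      then show "t \<in> T (side \<sigma> y x) \<union> T (side \<sigma> y z)"
        using t by (auto simp: T_def f_def intro: infdist_le2)
    qed
    moreover have "0 \<in> T (side \<sigma> y x)" "1 \<in> T (side \<sigma> y z)"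
      using D0 by (auto simp: T_def f_def intro: infdist_le2)
    moreover have "connected {0..1::real}" by simp
    ultimately show False
      using closed empty unfolding connected_closed by (metis Int_iff atLeastAtMost_iff empty_iff inf_bot_left inf_commute order.refl zero_le_one)
  qed
  then obtain t where "t \<in> T (side \<sigma> y x)" "t \<in> T (side \<sigma> y z)" by blast
  moreover from this have "\<sigma> x z t \<in> side \<sigma> x z" by (auto simp: T_def side_def)
  ultimately show ?thesis using that near by blast
qed

text \<open>Take p on the side from x to z near both sides at y; thinness at w puts p also near a
  side from w to x or to z. Routing w to y through p then compares with one of the two sums in the
  maximum, at the price of two detours of 2(D + 1) each.\<close>

lemma thin_imp_hyperbolic:
  assumes "thin D" "D \<ge> 0"
  shows "hyperbolic_space TYPE('a)"
proof -
  have via: "dist x p + dist p y \<le> dist x y + 2 * r" if "q \<in> side \<sigma> x y" "dist p q \<le> r" for x y p q r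
    using dist_via_side[OF that(1)] that(2) dist_triangle[of x p q] dist_triangle[of p y q]
    by (simp add: dist_commute)
  have "dist w y + dist x z \<le> max (dist w x + dist y z) (dist w z + dist x y) + 2 * (2 * (D + 1))" for w x y z :: 'a
  proof -
    obtain p q q' where p: "p \<in> side \<sigma> x z" and q: "q \<in> side \<sigma> y x" "dist p q \<le> D + 1"
      and q': "q' \<in> side \<sigma> y z" "dist p q' \<le> D + 1"
      using side_near_both[OF assms(1)] by metis
    have xz: "dist x z = dist x p + dist p z" by (rule dist_via_side[OF p])
    have yx: "dist y p + dist p x \<le> dist y x + 2 * (D + 1)" by (rule via[OF q])
    have yz: "dist y p + dist p z \<le> dist y z + 2 * (D + 1)" by (rule via[OF q'])
    have wy: "dist w y \<le> dist w p + dist p y" by (rule dist_triangle)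
    obtain u where u: "u \<in> side \<sigma> w x \<union> side \<sigma> w z" "dist p u \<le> D"
      using assms(1) p unfolding thin_def by meson
    then have u': "dist p u \<le> D + 1" by simp
    show ?thesis
    proof (cases "u \<in> side \<sigma> w x")
      case True
      then have "dist w p + dist p x \<le> dist w x + 2 * (D + 1)" using u' by (rule via)
      then show ?thesis using xz yz wy by (simp add: dist_commute max_def)
    next
      case False
      then have "dist w p + dist p z \<le> dist w z + 2 * (D + 1)" using u u' by (intro via[of u]) auto
      then show ?thesis using xz yx wy by (simp add: dist_commute max_def)
    qed
  qed
  then show ?thesis unfolding hyperbolic_space_def using assms(2) by (intro exI[of _ "2 * (D + 1)"]) auto
qed

text \<open>Both points retreat towards z at the same parameter, u by 16 D. By conicality the
  retreated points stay within 10 D of each other, so every point between them is at least 6 D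
  closer to z than u is, whereas p is within 5 D of u. The point v retreats by at most 16 D + 10 D.
  If u is within 16 D of z, the apex z itself serves.\<close>

lemma bridge:
  assumes D: "D > 0" and u: "u \<in> side \<sigma> z x" and v: "v \<in> side \<sigma> z y"
    and uv: "dist u v \<le> 10 * D" and pu: "dist p u \<le> 5 * D"
    and avoid: "\<And>q. q \<in> side \<sigma> z x \<union> side \<sigma> z y \<Longrightarrow> D \<le> dist p q"
  obtains u' v' where "u' \<in> side \<sigma> z x" "v' \<in> side \<sigma> z y"
    "dist u u' \<le> 26 * D" "dist v v' \<le> 26 * D" "dist u' v' \<le> 26 * D"
    "\<And>q. q \<in> side \<sigma> u' v' \<Longrightarrow> D \<le> dist p q"
proof (cases "dist z u \<le> 16 * D")
  case True
  show ?thesis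
  proof (rule that[of z z])
    show "dist v z \<le> 26 * D" using True uv dist_triangle[of v z u] by (simp add: dist_commute)
  qed (use True D avoid[of z] in \<open>auto simp: dist_commute\<close>)
next
  case False
  define t where "t = 1 - 16 * D / dist z u"
  have zu: "dist z u > 16 * D" using False by simp
  then have zu0: "dist z u > 0" using D by linarith
  have t: "t \<in> {0..1}" using D zu zu0 by (auto simp: t_def pos_divide_le_eq)
  have t1: "(1 - t) * dist z u = 16 * D" using zu0 by (simp add: t_def)
  let ?u = "\<sigma> z u t" and ?v = "\<sigma> z v t"
  have u'v': "dist ?u ?v \<le> 10 * D"
  proof -
    have "dist ?u ?v \<le> t * dist u v" using combing_conical[OF t, of z u z v] by simp
    also have "\<dots> \<le> 1 * dist u v" using t by (intro mult_right_mono) auto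
    finally show ?thesis using uv by simp
  qed
  show ?thesis
  proof (rule that[of ?u ?v])
    show "?u \<in> side \<sigma> z x" using side_subset[OF left_in_side u] t by (auto simp: side_def)
    show "?v \<in> side \<sigma> z y" using side_subset[OF left_in_side v] t by (auto simp: side_def)
    show "dist u ?u \<le> 26 * D" using dist_combing_right[OF t, of z u] t1 D by (simp add: dist_commute)
    have "dist z v \<le> dist z u + 10 * D" using uv dist_triangle[of z v u] by simp
    then have "(1 - t) * dist z v \<le> (1 - t) * (dist z u + 10 * D)" using t by (intro mult_left_mono) auto
    also have "\<dots> = 16 * D + (1 - t) * (10 * D)" using t1 by (simp add: distrib_left)
    also have "(1 - t) * (10 * D) \<le> 1 * (10 * D)" using t D by (intro mult_right_mono) auto
    finally show "dist v ?v \<le> 26 * D" using dist_combing_right[OF t, of z v] by (simp add: dist_commute)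
    show "dist ?u ?v \<le> 26 * D" using u'v' D by simp
    fix q assume "q \<in> side \<sigma> ?u ?v"
    then have "dist ?u q \<le> 10 * D" using dist_side_le u'v' by (meson order.trans)
    moreover have "dist z ?u = dist z u - 16 * D" using dist_combing_left[OF t, of z u] t1 by (simp add: algebra_simps)
    ultimately have "dist z q \<le> dist z u - 6 * D" using dist_triangle[of z q ?u] by simp
    moreover have "dist z u \<le> dist z q + dist p q + dist p u"
      using dist_triangle[of z u q] dist_triangle[of q u p] by (simp add: dist_commute)
    ultimately show "D \<le> dist p q" using pu by linarith
  qed
qed

text \<open>The side is left at distance 3 D from the point at t0, by a jump of at most 2 D, so the
  jump stays at distance D from it. If x is already within 3 D, x itself is the exit and the jump is
  trivial.\<close>

lemma exit_point:
  assumes D: "D > 0" and t0: "t0 \<in> {0..1}" and far: "D \<le> t0 * dist x y"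
    and near: "\<And>p. p \<in> side \<sigma> x y \<Longrightarrow> \<exists>u\<in>A. dist p u \<le> 2 * D"
    and x: "x \<in> A"
  obtains s u where "0 \<le> s" "s \<le> t0" "D \<le> (t0 - s) * dist x y" "(t0 - s) * dist x y \<le> 3 * D"
    "u \<in> A" "dist (\<sigma> x y s) u \<le> 2 * D" "\<And>q. q \<in> side \<sigma> (\<sigma> x y s) u \<Longrightarrow> D \<le> dist (\<sigma> x y t0) q"
proof (cases "t0 * dist x y \<le> 3 * D")
  case True
  show ?thesis
  proof (rule that[of 0 x])
    fix q assume "q \<in> side \<sigma> (\<sigma> x y 0) x"
    then show "D \<le> dist (\<sigma> x y t0) q" using dist_combing_left[OF t0, of x y] far by (simp add: dist_commute)
  qed (use True D t0 far x in auto)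
next
  case False
  have l0: "dist x y > 0" using False D t0 by (cases "dist x y = 0") (auto simp: zero_less_dist_iff)
  define s where "s = t0 - 3 * D / dist x y"
  have s: "(t0 - s) * dist x y = 3 * D" using l0 by (simp add: s_def)
  have s0: "0 \<le> s" using False l0 by (simp add: s_def pos_divide_le_eq)
  have st: "s \<le> t0" using l0 D by (simp add: s_def)
  have s1: "s \<in> {0..1}" using s0 st t0 by auto
  then obtain u where u: "u \<in> A" "dist (\<sigma> x y s) u \<le> 2 * D"
    using near[of "\<sigma> x y s"] by (auto simp: side_def)
  show ?thesis
  proof (rule that[OF s0 st _ _ u])
    fix q assume "q \<in> side \<sigma> (\<sigma> x y s) u"
    then have "dist (\<sigma> x y s) q \<le> 2 * D" using dist_side_le u(2) by (meson order.trans)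
    moreover have "dist (\<sigma> x y t0) (\<sigma> x y s) = 3 * D"
      using dist_combing[OF t0 s1, of x y] s st by simp
    ultimately show "D \<le> dist (\<sigma> x y t0) q"
      using dist_triangle[of "\<sigma> x y t0" "\<sigma> x y s" q] by (simp add: dist_commute)
  qed (use s D in auto)
qed

text \<open>The triangle may be huge compared with D. Centring at the point farthest from the other
  two sides keeps all other points of the side within 2 D of them, so one can leave the side on both
  sides of that point and close up by a bridge, with all lengths of order D.\<close>

lemma not_thin_imp_fat_hexagon:
  assumes "\<not> thin D0" "D0 > 0"
  obtains D a \<tau> where "D \<ge> D0" "fat_hexagon D a \<tau>"
proof -
  obtain x y z p0 where p0: "p0 \<in> side \<sigma> x y" "\<And>q. q \<in> side \<sigma> z x \<union> side \<sigma> z y \<Longrightarrow> D0 < dist p0 q"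
    using assms(1) unfolding thin_def by (meson not_le)
  define A where "A = side \<sigma> z x \<union> side \<sigma> z y"
  have A: "x \<in> A" "y \<in> A" "A \<noteq> {}" unfolding A_def using left_in_side by (simp_all, blast)
  have "continuous_on {0..1} (\<lambda>t. infdist (\<sigma> x y t) A)"
    by (intro continuous_on_infdist continuous_on_combing)
  then obtain t0 where t0: "t0 \<in> {0..1}" and max: "\<And>t. t \<in> {0..1} \<Longrightarrow> infdist (\<sigma> x y t) A \<le> infdist (\<sigma> x y t0) A"
    using continuous_attains_sup[of "{0..1::real}" "\<lambda>t. infdist (\<sigma> x y t) A"] by auto
  define D where "D = infdist (\<sigma> x y t0) A"
  let ?p = "\<sigma> x y t0"
  have "D0 \<le> infdist p0 A"
    unfolding infdist_notempty[OF A(3)]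
    by (intro cINF_greatest[OF A(3)] less_imp_le p0(2)) (simp add: A_def)
  then have DD: "D0 \<le> D" using p0(1) max unfolding side_def D_def by force
  then have D: "D > 0" using assms(2) by simp
  have avoid: "D \<le> dist ?p q" if "q \<in> A" for q using infdist_le[OF that] by (simp add: D_def)
  have near: "\<exists>u\<in>A. dist p u \<le> 2 * D" if p: "p \<in> side \<sigma> x y" for p
  proof -
    have "infdist p A \<le> D" using p max by (auto simp: side_def D_def)
    then have "infdist p A < 2 * D" using D by simp
    then have "\<exists>r\<in>dist p ` A. r < 2 * D"
      unfolding infdist_notempty[OF A(3)] using A(3)
      by (subst (asm) cInf_less_iff) (auto intro!: bdd_belowI[of _ 0])
    then show ?thesis by force
  qed
  let ?l = "dist x y"
  have far: "D \<le> t0 * ?l" using avoid[OF A(1)] dist_combing_left[OF t0, of x y] by (simp add: dist_commute)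
  have far': "D \<le> (1 - t0) * dist y x" using avoid[OF A(2)] dist_combing_right[OF t0, of x y] by (simp add: dist_commute)
  obtain s u where s: "0 \<le> s" "s \<le> t0" "D \<le> (t0 - s) * ?l" "(t0 - s) * ?l \<le> 3 * D"
    and u: "u \<in> A" "dist (\<sigma> x y s) u \<le> 2 * D" "\<And>q. q \<in> side \<sigma> (\<sigma> x y s) u \<Longrightarrow> D \<le> dist ?p q"
    using exit_point[OF D t0 far near A(1)] by metis
  have t1: "1 - t0 \<in> {0..1}" using t0 by auto
  have near': "\<And>p. p \<in> side \<sigma> y x \<Longrightarrow> \<exists>u\<in>A. dist p u \<le> 2 * D"
    using near side_commute[of x y] by simp
  obtain s' v where s': "0 \<le> s'" "s' \<le> 1 - t0" "D \<le> (1 - t0 - s') * dist y x" "(1 - t0 - s') * dist y x \<le> 3 * D"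
    and v: "v \<in> A" "dist (\<sigma> y x s') v \<le> 2 * D" "\<And>q. q \<in> side \<sigma> (\<sigma> y x s') v \<Longrightarrow> D \<le> dist (\<sigma> y x (1 - t0)) q"
    using exit_point[OF D t1 far' near' A(2)] by metis
  have rev: "\<sigma> y x (1 - t0) = ?p" using combing_rev[OF t1, of y x] by simp
  define r where "r = 1 - s'"
  have s'01: "s' \<in> {0..1}" using s' t0 by auto
  have r: "t0 \<le> r" "r \<le> 1" "D \<le> (r - t0) * ?l" "(r - t0) * ?l \<le> 3 * D" "\<sigma> y x s' = \<sigma> x y r"
    using s' combing_rev[OF s'01, of y x] by (simp_all add: r_def dist_commute diff_diff_eq algebra_simps)
  let ?x = "\<sigma> x y s" and ?y = "\<sigma> x y r"
  have l0: "?l > 0" using far D by (cases "?l = 0") (auto simp: zero_less_dist_iff)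
  have s01: "s \<in> {0..1}" and r01: "r \<in> {0..1}" using s r t0 by auto
  have xy: "dist ?x ?y = (r - s) * ?l" using dist_combing[OF s01 r01] s r by simp
  define \<tau> where "\<tau> = (t0 - s) / (r - s)"
  have "s < t0" "t0 < r" using s(2,3) r(1,3) D by (auto simp: order_le_less)
  then have rs: "r - s > 0" by simp
  have \<tau>: "\<tau> \<in> {0..1}" using s r rs by (auto simp: \<tau>_def pos_divide_le_eq)
  \<comment> \<open>Consistency makes the new first side run along the old one, so it still passes
    through the fattest point.\<close>
  have p: "\<sigma> ?x ?y \<tau> = ?p"
    using combing_subsegment[of s r \<tau> x y] s r \<tau> rs by (simp add: \<tau>_def)
  have \<tau>1: "\<tau> * dist ?x ?y = (t0 - s) * ?l" "(1 - \<tau>) * dist ?x ?y = (r - t0) * ?l"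
    using rs unfolding xy \<tau>_def by (simp_all add: field_simps)
  have px: "dist ?p ?x \<le> 3 * D" using dist_combing[OF t0 s01, of x y] s by simp
  have xy6: "dist ?x ?y \<le> 6 * D"
    using s(4) r(4) xy by (simp add: algebra_simps)
  have uv: "dist u v \<le> 10 * D"
    using u(2) v(2) xy6 dist_triangle[of u v ?x] dist_triangle[of ?x v ?y] r(5) by (simp add: dist_commute)
  have pu: "dist ?p u \<le> 5 * D" using px u(2) dist_triangle[of ?p u ?x] by simp
  \<comment> \<open>The two exits may land on the same side of the triangle, so the bridge is
    applied with arbitrary far ends \<open>B\<close> and \<open>B'\<close>.\<close>
  obtain B B' u' v' where uv': "B \<in> {x, y}" "B' \<in> {x, y}" "u \<in> side \<sigma> z B" "v \<in> side \<sigma> z B'"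
    "u' \<in> side \<sigma> z B" "v' \<in> side \<sigma> z B'"
    "dist u u' \<le> 26 * D" "dist v v' \<le> 26 * D" "dist u' v' \<le> 26 * D"
    "\<And>q. q \<in> side \<sigma> u' v' \<Longrightarrow> D \<le> dist ?p q"
  proof -
    obtain B B' where BB: "B \<in> {x, y}" "B' \<in> {x, y}" "u \<in> side \<sigma> z B" "v \<in> side \<sigma> z B'"
      using u(1) v(1) unfolding A_def by blast
    have "\<And>q. q \<in> side \<sigma> z B \<union> side \<sigma> z B' \<Longrightarrow> D \<le> dist ?p q"
      using BB avoid unfolding A_def by blast
    from bridge[OF D BB(3,4) uv pu this] show ?thesis using that[OF BB] by metis
  qed
  have sub: "side \<sigma> v v' \<subseteq> A" "side \<sigma> u' u \<subseteq> A"
    using uv' side_subset[of v z B' v'] side_subset[of u' z B u] unfolding A_def by auto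
  define a where "a = nth [?x, ?y, v, v', u', u, ?x]"
  have a: "a 0 = ?x" "a 1 = ?y" "a (Suc (Suc 0)) = v" "a 2 = v" "a (Suc 0) = ?y" "a (Suc 1) = v" "a (Suc 2) = v'" "a 3 = v'" "a (Suc 3) = u'" "a 4 = u'"
    "a (Suc 4) = u" "a 5 = u" "a (Suc 5) = ?x" "a 6 = ?x"
    by (simp_all add: a_def eval_nat_numeral)
  have six: "k = 0 \<or> k = 1 \<or> k = 2 \<or> k = 3 \<or> k = 4 \<or> k = 5" if "k < 6" for k :: nat using that by linarith
  have "fat_hexagon D a \<tau>"
    unfolding fat_hexagon_def
  proof (intro conjI allI impI ballI)
    show "a 6 = a 0" by (simp add: a)
    show "\<tau> \<in> {0..1}" by (rule \<tau>)
    show "D \<le> \<tau> * dist (a 0) (a 1)" "D \<le> (1 - \<tau>) * dist (a 0) (a 1)"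
      unfolding a \<tau>1 by (rule s r)+
    fix k :: nat
    show "dist (a k) (a (Suc k)) \<le> 26 * D" if "k < 6"
      using six[OF that] xy6 v(2) r(5) uv' u(2) D by (elim disjE) (simp_all add: a dist_commute)
    fix q assume k: "1 \<le> k \<and> k < 6" and q: "q \<in> side \<sigma> (a k) (a (Suc k))"
    have "D \<le> dist ?p q"
      using six[OF conjunct2[OF k]] k
    proof (elim disjE conjE)
      assume "k = 1" then show ?thesis using q v(3) rev r(5) by (simp add: a del: One_nat_def)
    next
      assume "k = 2" then show ?thesis using q avoid sub(1) by (auto simp: a)
    next
      assume "k = 3" then show ?thesis using q uv'(10) side_commute[of v' u'] by (simp add: a)
    next
      assume "k = 4" then show ?thesis using q avoid sub(2) by (auto simp: a)
    next
      assume "k = 5" then show ?thesis using q u(3) side_commute[of u ?x] by (simp add: a)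
    qed auto
    then show "D \<le> dist (\<sigma> (a 0) (a 1) \<tau>) q" unfolding a p .
  qed
  then show ?thesis using that DD by blast
qed

end

section \<open>Limits of grid maps\<close>

text \<open>Tychonoff's theorem. The index set will be the plane, which is uncountable, so the limit
  is taken along a filter finer than \<open>sequentially\<close> instead of a subsequence.\<close>

lemma pointwise_compactness:
  fixes f :: "nat \<Rightarrow> 'i \<Rightarrow> 'b::topological_space"
  assumes "\<And>i. compact (S i)" "\<And>k i. f k i \<in> S i"
  obtains G g where "G \<noteq> bot" "G \<le> sequentially" "\<And>i. ((\<lambda>k. f k i) \<longlongrightarrow> g i) G"
proof -
  have "compact (Pi\<^sub>E UNIV S)"
    using compactin_PiE[of "\<lambda>i. euclidean" UNIV S] assms(1) by (simp add: euclidean_product_topology)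
  moreover have "eventually (\<lambda>x. x \<in> Pi\<^sub>E UNIV S) (filtermap f sequentially)"
    using assms(2) by (simp add: eventually_filtermap PiE_UNIV_domain)
  moreover have "filtermap f sequentially \<noteq> bot" by (simp add: filtermap_bot_iff)
  ultimately obtain g where g: "inf (nhds g) (filtermap f sequentially) \<noteq> bot"
    unfolding compact_filter by blast
  define G where "G = inf (filtercomap f (nhds g)) sequentially"
  have "G \<noteq> bot"
  proof
    assume "G = bot"
    then have "eventually (\<lambda>_. False) G" by simp
    then obtain P Q where P: "eventually P (nhds g)" and Q: "eventually Q sequentially"
      and PQ: "\<And>k. \<not> (P (f k) \<and> Q k)"
      unfolding G_def eventually_inf eventually_filtercomap by metis
    have "eventually (\<lambda>x. \<not> P x) (filtermap f sequentially)"
      unfolding eventually_filtermap using Q by (rule eventually_mono) (use PQ in blast)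
    then have "eventually (\<lambda>_. False) (inf (nhds g) (filtermap f sequentially))"
      using P unfolding eventually_inf by blast
    then show False using g by (simp add: eventually_False)
  qed
  moreover have "G \<le> sequentially" by (simp add: G_def)
  moreover have "((\<lambda>k. f k i) \<longlongrightarrow> g i) G" for i
  proof -
    have "filterlim f (nhds g) (filtercomap f (nhds g))" by (rule filterlim_filtercomap)
    then have "filterlim f (nhds g) G" by (rule filterlim_mono) (auto simp: G_def)
    then show ?thesis
      using continuous_on_tendsto_compose[OF continuous_on_product_coordinates[of i]] by auto
  qed
  ultimately show ?thesis using that by blast
qed

lemma isometry_into_compact:
  assumes "cocompact_isometry_group TYPE('a::metric_space)"
  obtains K :: "'a::metric_space set" where "compact K"
    "\<And>y. \<exists>g :: 'a::metric_space \<Rightarrow> 'a. g y \<in> K \<and> (\<forall>u v. dist (g u) (g v) = dist u v)"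
proof -
  obtain K :: "'a set" where K: "compact K" "(\<Union>g\<in>{g. isometry g}. g ` K) = UNIV"
    using assms unfolding cocompact_isometry_group_def by blast
  have "\<exists>g :: 'a \<Rightarrow> 'a. g y \<in> K \<and> (\<forall>u v. dist (g u) (g v) = dist u v)" for y
  proof -
    obtain h where h: "isometry h" "y \<in> h ` K" using K(2) by blast
    then have "bij h" and iso: "\<And>u v. dist (h u) (h v) = dist u v" by (simp_all add: isometry_def)
    then have "dist (inv h u) (inv h v) = dist u v" for u v
      by (metis bij_inv_eq_iff)
    moreover have "inv h y \<in> K" using h(2) \<open>bij h\<close> by (auto simp: bij_is_inj)
    ultimately show ?thesis by blast
  qed
  then show ?thesis using that K(1) by blast
qed

section \<open>Rescaled grids\<close>

definition coord :: "nat \<Rightarrow> real \<times> real \<Rightarrow> int \<times> int" where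
  "coord k x = (\<lfloor>k * fst x\<rfloor>, \<lfloor>k * snd x\<rfloor>)"

definition norm1 :: "real \<times> real \<Rightarrow> real" where
  "norm1 x = \<bar>fst x\<bar> + \<bar>snd x\<bar>"

lemma floor_diff_le: "\<bar>real_of_int (\<lfloor>a\<rfloor> - \<lfloor>b\<rfloor>)\<bar> \<le> \<bar>a - b\<bar> + 1"
  by linarith

lemma size1_coord_diff: "size1 (coord k y - coord k x) \<le> k * norm1 (y - x) + 2"
proof -
  have "\<bar>real k * (a - b)\<bar> = k * \<bar>a - b\<bar>" for a b :: real by (simp add: abs_mult)
  then show ?thesis
    using floor_diff_le[of "k * fst y" "k * fst x"] floor_diff_le[of "k * snd y" "k * snd x"]
    by (simp add: size1_def coord_def norm1_def right_diff_distrib[symmetric] distrib_left)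
qed

lemma size1_coord_add: "size1 (coord k (x + y) - (coord k x + coord k y)) \<le> 2"
proof -
  have "\<bar>real_of_int (\<lfloor>a + b\<rfloor> - (\<lfloor>a\<rfloor> + \<lfloor>b\<rfloor>))\<bar> \<le> 1" for a b :: real by (simp add: floor_add)
  from this[of "k * fst x" "k * fst y"] this[of "k * snd x" "k * snd y"]
  show ?thesis by (simp add: size1_def coord_def distrib_left)
qed

lemma size1_triangle: "size1 (u + v) \<le> size1 u + size1 v"
  by (simp add: size1_def)

definition lattice_point :: "int \<times> int \<Rightarrow> real \<times> real" where
  "lattice_point q = (real_of_int (fst q), real_of_int (snd q))"

lemma coord_lattice_point: "coord k (lattice_point q) = nmult k q"
proof -
  have "\<lfloor>real k * real_of_int i\<rfloor> = int k * i" for i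
    by (metis floor_of_int of_int_mult of_int_of_nat_eq)
  then show ?thesis by (simp add: coord_def lattice_point_def nmult_def)
qed

text \<open>The window has radius (k + 1)^2 while the rescaled coordinates of a fixed point grow
  only linearly in k. So every fixed position and direction is eventually controlled by the defect
  bounds.\<close>

lemma eventually_coord_in:
  "eventually (\<lambda>k. coord (Suc k) x \<in> {- int ((Suc k)\<^sup>2)..int ((Suc k)\<^sup>2)} \<times> {- int ((Suc k)\<^sup>2)..int ((Suc k)\<^sup>2)}) sequentially"
proof -
  have *: "eventually (\<lambda>k. \<lfloor>Suc k * a\<rfloor> \<in> {- int ((Suc k)\<^sup>2)..int ((Suc k)\<^sup>2)}) sequentially" for a :: real
    using eventually_ge_at_top[of "nat \<lceil>\<bar>a\<bar> + 1\<rceil>"]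
  proof eventually_elim
    case (elim k)
    then have "\<bar>a\<bar> + 1 \<le> Suc k" by linarith
    then have "Suc k * (\<bar>a\<bar> + 1) \<le> Suc k * real (Suc k)" by (intro mult_left_mono) auto
    moreover have "\<bar>Suc k * a\<bar> + 1 \<le> Suc k * (\<bar>a\<bar> + 1)" by (simp add: abs_mult distrib_left)
    moreover have "real_of_int (int ((Suc k)\<^sup>2)) = Suc k * real (Suc k)"
      by (simp only: of_int_of_nat_eq power2_eq_square of_nat_mult of_int_mult)
    ultimately have "\<bar>Suc k * a\<bar> + 1 \<le> real_of_int (int ((Suc k)\<^sup>2))" by linarith
    then show ?case unfolding atLeastAtMost_iff by linarith
  qed
  show ?thesis
    using *[of "fst x"] *[of "snd x"] by eventually_elim (simp add: coord_def)
qed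

definition midpoint_rigid :: "(real \<times> real \<Rightarrow> 'b::metric_space) \<Rightarrow> bool" where
  "midpoint_rigid \<Phi> \<longleftrightarrow> (\<forall>x y. dist (\<Phi> x) (\<Phi> y) \<le> norm1 (y - x)) \<and>
     (\<forall>x v. dist (\<Phi> (x + v)) (\<Phi> (x + v + v)) = dist (\<Phi> x) (\<Phi> (x + v)) \<and>
            dist (\<Phi> x) (\<Phi> (x + v + v)) = 2 * dist (\<Phi> x) (\<Phi> (x + v)))"

text \<open>At stage k the mesh is 1/(k + 1), the defects are at most 1/(k + 1) and the window is
  large. Isometries bring the base points into a compact set, and properness gives pointwise
  limits.\<close>

proposition rigid_limit:
  fixes c :: real
  assumes proper: "proper_metric_space TYPE('a::metric_space)"
    and cocompact: "cocompact_isometry_group TYPE('a::metric_space)"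
    and stage: "\<And>k V \<eta>. k > 0 \<Longrightarrow> finite V \<Longrightarrow> \<eta> > 0 \<Longrightarrow>
     \<exists>F p (\<phi> :: 'a::metric_space \<Rightarrow> complex). step_lipschitz (1 / real k) F \<and> (\<forall>x y. dist (\<phi> x) (\<phi> y) \<le> 2 * dist x y) \<and>
       (\<forall>q\<in>V. \<forall>v\<in>V. defect v F (p + q) \<le> \<eta>) \<and>
       (\<Sum>q\<in>grid m0. cell (int k, 0) (0, int k) (\<phi> \<circ> F) (p + nmult k q)) \<ge> c"
  obtains \<Phi> :: "real \<times> real \<Rightarrow> 'a::metric_space" and P where "midpoint_rigid \<Phi>"
    "\<And>x y. dist (P x) (P y) \<le> 2 * dist (\<Phi> x) (\<Phi> y)" "circ m0 (P \<circ> lattice_point) \<ge> c"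
proof -
  obtain K :: "'a set" where K: "compact K"
    and iso: "\<And>y. \<exists>g :: 'a::metric_space \<Rightarrow> 'a. g y \<in> K \<and> (\<forall>u v. dist (g u) (g v) = dist u v)"
    using isometry_into_compact[OF cocompact] by metis
  obtain x0 r where Kr: "K \<subseteq> cball x0 r" using compact_imp_bounded[OF K] by (metis bounded_subset_cball)
  define V where "V k = {- int ((Suc k)\<^sup>2)..int ((Suc k)\<^sup>2)} \<times> {- int ((Suc k)\<^sup>2)..int ((Suc k)\<^sup>2)}" for k
  have "\<forall>k. \<exists>F p (\<phi> :: 'a \<Rightarrow> complex). step_lipschitz (1 / real (Suc k)) F \<and> (\<forall>x y. dist (\<phi> x) (\<phi> y) \<le> 2 * dist x y) \<and>
       (\<forall>q\<in>V k. \<forall>v\<in>V k. defect v F (p + q) \<le> 1 / real (Suc k)) \<and>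
       (\<Sum>q\<in>grid m0. cell (int (Suc k), 0) (0, int (Suc k)) (\<phi> \<circ> F) (p + nmult (Suc k) q)) \<ge> c"
    by (intro allI stage) (auto simp: V_def)
  then obtain F p and \<phi> :: "nat \<Rightarrow> 'a \<Rightarrow> complex" where F: "\<And>k. step_lipschitz (1 / real (Suc k)) (F k)"
    and phi: "\<And>k x y. dist (\<phi> k x) (\<phi> k y) \<le> 2 * dist x y"
    and defect: "\<And>k q v. q \<in> V k \<Longrightarrow> v \<in> V k \<Longrightarrow> defect v (F k) (p k + q) \<le> 1 / real (Suc k)"
    and cells: "\<And>k. (\<Sum>q\<in>grid m0. cell (int (Suc k), 0) (0, int (Suc k)) (\<phi> k \<circ> F k) (p k + nmult (Suc k) q)) \<ge> c"
    by metis
  have "\<forall>k. \<exists>g :: 'a \<Rightarrow> 'a. g (F k (p k)) \<in> K \<and> (\<forall>u v. dist (g u) (g v) = dist u v)"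
    using iso by blast
  then obtain \<gamma> :: "nat \<Rightarrow> 'a \<Rightarrow> 'a" where \<gamma>: "\<And>k. \<gamma> k (F k (p k)) \<in> K" "\<And>k u v. dist (\<gamma> k u) (\<gamma> k v) = dist u v"
    by (auto dest!: choice)
  define A where "A k q = \<gamma> k (F k (p k + q))" for k q
  have A: "dist (A k q) (A k q') \<le> size1 (q' - q) / Suc k" for k q q'
    using step_lipschitzD[OF F, where p = "p k + q" and v = "q' - q" and k1 = k] by (simp add: A_def \<gamma>)
  \<comment> \<open>The charts vary with k, so their values along the grid map are carried along as
    a second component, normalised to vanish at the base point to keep them bounded. One filter then
    serves both components.\<close>
  define \<Psi> where "\<Psi> k x = (A k (coord (Suc k) x),
     \<phi> k (F k (p k + coord (Suc k) x)) - \<phi> k (F k (p k)))" for k x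
  have Psi_dist: "dist (fst (\<Psi> k x)) (fst (\<Psi> k y)) \<le> norm1 (y - x) + 2 / Suc k" for k x y
  proof -
    have "dist (fst (\<Psi> k x)) (fst (\<Psi> k y)) \<le> size1 (coord (Suc k) y - coord (Suc k) x) / Suc k"
      unfolding \<Psi>_def fst_conv by (rule A)
    also have "\<dots> \<le> (Suc k * norm1 (y - x) + 2) / Suc k"
      by (intro divide_right_mono size1_coord_diff) simp
    finally show ?thesis by (simp add: add_divide_distrib)
  qed
  have Psi_snd: "dist (snd (\<Psi> k x)) (snd (\<Psi> k y)) \<le> 2 * dist (fst (\<Psi> k x)) (fst (\<Psi> k y))" for k x y
  proof -
    have "dist (snd (\<Psi> k x)) (snd (\<Psi> k y))
        = dist (\<phi> k (F k (p k + coord (Suc k) x))) (\<phi> k (F k (p k + coord (Suc k) y)))"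
      by (simp add: \<Psi>_def dist_norm)
    then show ?thesis using phi by (simp add: \<Psi>_def A_def \<gamma>)
  qed
  define S where "S x = cball x0 (r + norm1 x + 2) \<times> cball (0::complex) (2 * (norm1 x + 2))" for x
  have S: "compact (S x)" for x
    using proper unfolding S_def proper_metric_space_def by (intro compact_Times) auto
  have PsiS: "\<Psi> k x \<in> S x" for k x
  proof -
    have "coord (Suc k) 0 = 0" by (simp add: coord_def zero_prod_def)
    then have 0: "fst (\<Psi> k 0) = \<gamma> k (F k (p k))" "snd (\<Psi> k 0) = 0" by (simp_all add: \<Psi>_def A_def)
    have "2 / real (Suc k) \<le> 2" by (simp add: pos_divide_le_eq)
    then have 1: "dist (fst (\<Psi> k 0)) (fst (\<Psi> k x)) \<le> norm1 x + 2"
      using Psi_dist[of k 0 x] by simp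
    moreover have "dist x0 (fst (\<Psi> k 0)) \<le> r" using Kr \<gamma>(1)[of k] 0 by auto
    ultimately have "dist x0 (fst (\<Psi> k x)) \<le> r + norm1 x + 2"
      using dist_triangle[of x0 "fst (\<Psi> k x)" "fst (\<Psi> k 0)"] by linarith
    moreover have "dist 0 (snd (\<Psi> k x)) \<le> 2 * (norm1 x + 2)"
      using Psi_snd[of k 0 x] 0(2) 1 by simp
    ultimately show ?thesis by (simp add: S_def mem_Times_iff)
  qed
  obtain G \<psi> where G: "G \<noteq> bot" "G \<le> sequentially" and lim: "\<And>x. ((\<lambda>k. \<Psi> k x) \<longlongrightarrow> \<psi> x) G"
    using pointwise_compactness[of S \<Psi>, OF S PsiS] by metis
  define \<Phi> where "\<Phi> x = fst (\<psi> x)" for x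
  define P where "P x = snd (\<psi> x)" for x
  have lim1: "((\<lambda>k. fst (\<Psi> k x)) \<longlongrightarrow> \<Phi> x) G" and lim2: "((\<lambda>k. snd (\<Psi> k x)) \<longlongrightarrow> P x) G" for x
    unfolding \<Phi>_def P_def by (intro tendsto_fst tendsto_snd lim)+
  have inv: "((\<lambda>k. b / real (Suc k)) \<longlongrightarrow> 0) G" for b :: real
    using LIMSEQ_Suc[OF tendsto_divide_0[OF tendsto_const filterlim_real_at_infinity_sequentially, of b]]
    by (rule tendsto_mono[OF G(2)])
  \<comment> \<open>Rounding errors of bounded \<open>size1\<close> vanish in the limit because the
    mesh tends to 0. The bound 4 allows for two uses of \<open>size1_coord_add\<close>.\<close>
  have near: "((\<lambda>k. A k (f k)) \<longlongrightarrow> \<Phi> x) G" if f: "\<And>k. size1 (coord (Suc k) x - f k) \<le> 4" for f x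
  proof -
    have bd: "dist (A k (f k)) (fst (\<Psi> k x)) \<le> 4 / Suc k" for k
      using A[of k "f k" "coord (Suc k) x"] f[of k] unfolding \<Psi>_def
      by (simp add: divide_right_mono) (smt (verit) divide_right_mono of_nat_0_le_iff)
    have "((\<lambda>k. dist (A k (f k)) (fst (\<Psi> k x))) \<longlongrightarrow> 0) G"
      by (rule tendsto_sandwich[OF _ _ tendsto_const inv[of 4]]) (use bd in auto)
    moreover have "((\<lambda>k. dist (fst (\<Psi> k x)) (\<Phi> x)) \<longlongrightarrow> 0) G"
      using lim1 by (simp add: tendsto_dist_iff[symmetric])
    ultimately have "((\<lambda>k. dist (A k (f k)) (fst (\<Psi> k x)) + dist (fst (\<Psi> k x)) (\<Phi> x)) \<longlongrightarrow> 0 + 0) G"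
      by (rule tendsto_add)
    then have sum0: "((\<lambda>k. dist (A k (f k)) (fst (\<Psi> k x)) + dist (fst (\<Psi> k x)) (\<Phi> x)) \<longlongrightarrow> 0) G" by simp
    have "((\<lambda>k. dist (A k (f k)) (\<Phi> x)) \<longlongrightarrow> 0) G"
    proof (rule tendsto_sandwich[OF _ _ tendsto_const sum0])
      show "eventually (\<lambda>k. 0 \<le> dist (A k (f k)) (\<Phi> x)) G" by simp
      show "eventually (\<lambda>k. dist (A k (f k)) (\<Phi> x) \<le> dist (A k (f k)) (fst (\<Psi> k x)) + dist (fst (\<Psi> k x)) (\<Phi> x)) G"
        by (intro always_eventually allI dist_triangle)
    qed
    then show ?thesis by (simp add: tendsto_dist_iff[symmetric])
  qed
  have rigid: "midpoint_rigid \<Phi>"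
    unfolding midpoint_rigid_def
  proof (intro conjI allI)
    fix x y
    have "((\<lambda>k. norm1 (y - x) + 2 / real (Suc k)) \<longlongrightarrow> norm1 (y - x) + 0) G"
      by (intro tendsto_add tendsto_const inv)
    from tendsto_le[OF G(1) this tendsto_dist[OF lim1 lim1] always_eventually, of x y]
    show "dist (\<Phi> x) (\<Phi> y) \<le> norm1 (y - x)" using Psi_dist by simp
  next
    fix x v
    let ?x = "\<lambda>k. coord (Suc k) x" and ?v = "\<lambda>k. coord (Suc k) v"
    have 0: "((\<lambda>k. A k (?x k)) \<longlongrightarrow> \<Phi> x) G" by (rule near) (simp add: size1_def)
    have s1: "size1 (coord (Suc k) (x + v) - (?x k + ?v k)) \<le> 2" for k by (rule size1_coord_add)
    have 1: "((\<lambda>k. A k (?x k + ?v k)) \<longlongrightarrow> \<Phi> (x + v)) G"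
      by (rule near) (use s1 in \<open>smt (verit)\<close>)
    have "size1 (coord (Suc k) (x + v + v) - (?x k + ?v k + ?v k)) \<le> 4" for k
      using size1_triangle[of "coord (Suc k) (x + v + v) - (coord (Suc k) (x + v) + ?v k)" "coord (Suc k) (x + v) - (?x k + ?v k)"]
        size1_coord_add[of "Suc k" "x + v" v] s1[of k] by (simp add: algebra_simps)
    then have 2: "((\<lambda>k. A k (?x k + ?v k + ?v k)) \<longlongrightarrow> \<Phi> (x + v + v)) G" by (rule near)
    let ?a = "dist (\<Phi> x) (\<Phi> (x + v))" and ?b = "dist (\<Phi> (x + v)) (\<Phi> (x + v + v))" and ?c = "dist (\<Phi> x) (\<Phi> (x + v + v))"
    have dA: "defect (?v k) (F k) (p k + ?x k) =
       ((dist (A k (?x k)) (A k (?x k + ?v k)))\<^sup>2 + (dist (A k (?x k + ?v k)) (A k (?x k + ?v k + ?v k)))\<^sup>2) / 2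
        - (dist (A k (?x k)) (A k (?x k + ?v k + ?v k)))\<^sup>2 / 4" for k
      by (simp add: defect_def A_def \<gamma> add.assoc)
    have "((\<lambda>k. defect (?v k) (F k) (p k + ?x k)) \<longlongrightarrow> (?a\<^sup>2 + ?b\<^sup>2) / 2 - ?c\<^sup>2 / 4) G"
      unfolding dA by (intro tendsto_intros 0 1 2) auto
    moreover have "eventually (\<lambda>k. defect (?v k) (F k) (p k + ?x k) \<le> 1 / real (Suc k)) G"
    proof (rule filter_leD[OF G(2)])
      show "eventually (\<lambda>k. defect (?v k) (F k) (p k + ?x k) \<le> 1 / real (Suc k)) sequentially"
        using eventually_coord_in[of x] eventually_coord_in[of v]
        by eventually_elim (rule defect, simp_all add: V_def)
    qed
    ultimately have "(?a\<^sup>2 + ?b\<^sup>2) / 2 - ?c\<^sup>2 / 4 \<le> 0"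
      by (intro tendsto_le[OF G(1) inv[of 1]])
    \<comment> \<open>The vanishing limit defect and the triangle inequality squeeze a and b
      together, since 2 a^2 + 2 b^2 is at most (a + b)^2.\<close>
    moreover have "?c\<^sup>2 \<le> (?a + ?b)\<^sup>2" by (intro power_mono dist_triangle) auto
    ultimately have "(?a - ?b)\<^sup>2 \<le> 0"
      unfolding power2_sum power2_diff by argo
    then have ab: "?b = ?a" by simp
    have "4 * ?a\<^sup>2 \<le> ?c\<^sup>2" using \<open>(?a\<^sup>2 + ?b\<^sup>2) / 2 - ?c\<^sup>2 / 4 \<le> 0\<close> unfolding ab by argo
    then have "(2 * ?a)\<^sup>2 \<le> ?c\<^sup>2" by (simp add: power_mult_distrib)
    then have "2 * ?a \<le> ?c" by (rule power2_le_imp_le) simp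
    then show "?c = 2 * ?a" using ab dist_triangle[of "\<Phi> x" "\<Phi> (x + v + v)" "\<Phi> (x + v)"] by simp
    show "?b = ?a" by (rule ab)
  qed
  have PP: "dist (P x) (P y) \<le> 2 * dist (\<Phi> x) (\<Phi> y)" for x y
    by (rule tendsto_le[OF G(1) tendsto_mult[OF tendsto_const tendsto_dist[OF lim1 lim1]] tendsto_dist[OF lim2 lim2]])
      (simp add: Psi_snd)
  have "((\<lambda>k. \<Sum>q\<in>grid m0. cell (1, 0) (0, 1) (\<lambda>q. snd (\<Psi> k (lattice_point q))) q) \<longlongrightarrow> circ m0 (P \<circ> lattice_point)) G"
    unfolding circ_def cell_def quad_def cross_def comp_def by (intro tendsto_intros lim2)
  moreover have "(\<Sum>q\<in>grid m0. cell (1, 0) (0, 1) (\<lambda>q. snd (\<Psi> k (lattice_point q))) q) \<ge> c" for k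
  proof -
    \<comment> \<open>A cell depends only on differences of values, so the normalisation of the
      charts drops out.\<close>
    have "cell (1, 0) (0, 1) (\<lambda>q. snd (\<Psi> k (lattice_point q))) q
       = cell (int (Suc k), 0) (0, int (Suc k)) (\<phi> k \<circ> F k) (p k + nmult (Suc k) q)" for q
      unfolding cell_def quad_def \<Psi>_def coord_lattice_point
      by (simp add: nmult_def algebra_simps)
    then show ?thesis using cells[of k] by simp
  qed
  ultimately have "circ m0 (P \<circ> lattice_point) \<ge> c"
    by (intro tendsto_le[OF G(1) _ tendsto_const]) auto
  with rigid PP show ?thesis using that by blast
qed

section \<open>Maps that preserve midpoints\<close>

lemma norm1_scaleR: "norm1 (t *\<^sub>R v) = \<bar>t\<bar> * norm1 v"
  by (simp add: norm1_def abs_mult distrib_left)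

lemma norm1_nonneg: "0 \<le> norm1 v"
  by (simp add: norm1_def)

context
  fixes \<Phi> :: "real \<times> real \<Rightarrow> 'b::metric_space"
  assumes rigid: "midpoint_rigid \<Phi>"
begin

lemma rigid_lipschitz: "dist (\<Phi> x) (\<Phi> y) \<le> norm1 (y - x)"
  using rigid unfolding midpoint_rigid_def by blast

lemma rigid_double: "dist (\<Phi> x) (\<Phi> (x + 2 *\<^sub>R v)) = 2 * dist (\<Phi> x) (\<Phi> (x + v))"
proof -
  have "x + 2 *\<^sub>R v = x + v + v" by (simp add: scaleR_2 add.assoc)
  then show ?thesis using rigid unfolding midpoint_rigid_def by metis
qed

lemma rigid_pow2: "dist (\<Phi> x) (\<Phi> (x + (2 ^ n) *\<^sub>R v)) = 2 ^ n * dist (\<Phi> x) (\<Phi> (x + v))"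
proof (induction n)
  case (Suc n)
  then show ?case using rigid_double[of x "(2 ^ n) *\<^sub>R v"] by simp
qed simp

text \<open>Otherwise the discrepancy would double along \<open>2\<^sup>n v\<close>, yet it is bounded by \<open>2 d(\<Phi>(x), \<Phi>(y))\<close>.\<close>

lemma rigid_translation: "dist (\<Phi> x) (\<Phi> (x + v)) \<le> dist (\<Phi> y) (\<Phi> (y + v))"
proof (rule ccontr)
  assume "\<not> ?thesis"
  then have pos: "dist (\<Phi> x) (\<Phi> (x + v)) - dist (\<Phi> y) (\<Phi> (y + v)) > 0" (is "?e > 0") by simp
  have bound: "2 ^ n * ?e \<le> 2 * norm1 (y - x)" for n
  proof -
    let ?v = "(2 ^ n) *\<^sub>R v"
    have "dist (\<Phi> x) (\<Phi> (x + ?v)) \<le> dist (\<Phi> x) (\<Phi> y) + dist (\<Phi> y) (\<Phi> (y + ?v)) + dist (\<Phi> (y + ?v)) (\<Phi> (x + ?v))"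
      using dist_triangle[of "\<Phi> x" "\<Phi> (x + ?v)" "\<Phi> y"] dist_triangle[of "\<Phi> y" "\<Phi> (x + ?v)" "\<Phi> (y + ?v)"] by simp
    moreover have "dist (\<Phi> (y + ?v)) (\<Phi> (x + ?v)) \<le> norm1 (y - x)"
      using rigid_lipschitz[of "x + ?v" "y + ?v"] by (simp add: dist_commute)
    ultimately have "dist (\<Phi> x) (\<Phi> (x + ?v)) - dist (\<Phi> y) (\<Phi> (y + ?v)) \<le> 2 * norm1 (y - x)"
      using rigid_lipschitz[of x y] by simp
    then show ?thesis by (simp add: rigid_pow2 right_diff_distrib)
  qed
  obtain n where "2 * norm1 (y - x) / ?e < 2 ^ n" using real_arch_pow[of 2] by auto
  then show False using bound[of n] pos by (simp add: pos_divide_less_eq)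
qed

section \<open>The pulled-back seminorm\<close>

definition rnorm :: "real \<times> real \<Rightarrow> real" where
  "rnorm v = dist (\<Phi> 0) (\<Phi> v)"

lemma dist_rigid: "dist (\<Phi> x) (\<Phi> y) = rnorm (y - x)"
  using rigid_translation[of x "y - x" 0] rigid_translation[of 0 "y - x" x]
  by (simp add: rnorm_def)

lemma rnorm_0: "rnorm 0 = 0" by (simp add: rnorm_def)

lemma rnorm_nonneg: "0 \<le> rnorm v" by (simp add: rnorm_def)

lemma rnorm_le: "rnorm v \<le> norm1 v" using rigid_lipschitz[of 0 v] by (simp add: rnorm_def)

lemma rnorm_minus: "rnorm (- v) = rnorm v"
  using dist_rigid[of v 0] dist_rigid[of 0 v] by (simp add: dist_commute)

lemma rnorm_triangle: "rnorm (u + v) \<le> rnorm u + rnorm v"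
  using dist_triangle[of "\<Phi> 0" "\<Phi> (u + v)" "\<Phi> u"] by (simp add: dist_rigid)

lemma rnorm_diff_le: "\<bar>rnorm u - rnorm v\<bar> \<le> rnorm (u - v)"
  using rnorm_triangle[of "u - v" v] rnorm_triangle[of "v - u" u] rnorm_minus[of "u - v"] by simp

lemma rnorm_nat_le: "rnorm (real n *\<^sub>R v) \<le> n * rnorm v"
proof (induction n)
  case (Suc n)
  then show ?case using rnorm_triangle[of "real n *\<^sub>R v" v] by (simp add: algebra_simps)
qed (simp add: rnorm_0)

text \<open>Subadditivity gives one inequality. For the other, extend n to the power 2^n, where
  homogeneity is known by doubling, and bound the remaining 2^n - n copies by subadditivity.\<close>

lemma rnorm_nat: "rnorm (real n *\<^sub>R v) = n * rnorm v"
proof (rule antisym[OF rnorm_nat_le])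
  define m where "m = (2::nat) ^ n"
  have nm: "n \<le> m" unfolding m_def by (simp add: less_imp_le)
  have "m * rnorm v = rnorm (real m *\<^sub>R v)"
    using rigid_pow2[of 0 n v] by (simp add: rnorm_def m_def)
  also have "real m *\<^sub>R v = real n *\<^sub>R v + real (m - n) *\<^sub>R v"
    using nm by (simp add: of_nat_diff algebra_simps)
  also have "rnorm \<dots> \<le> rnorm (real n *\<^sub>R v) + real (m - n) * rnorm v"
    using rnorm_triangle rnorm_nat_le by (meson add_left_mono order.trans)
  finally show "n * rnorm v \<le> rnorm (real n *\<^sub>R v)"
    using nm by (simp add: of_nat_diff algebra_simps)
qed

text \<open>After multiplication by any n the discrepancy is only a rounding error of n t to an
  integer, at most 2 \<open>norm1 v\<close>; hence it is zero.\<close>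

lemma rnorm_scale_nonneg:
  assumes "t \<ge> 0"
  shows "rnorm (t *\<^sub>R v) = t * rnorm v"
proof -
  have bound: "n * \<bar>rnorm (t *\<^sub>R v) - t * rnorm v\<bar> \<le> 2 * norm1 v" for n :: nat
  proof -
    define k where "k = nat \<lfloor>n * t\<rfloor>"
    have "0 \<le> n * t" using assms by simp
    then have k: "\<bar>n * t - k\<bar> \<le> 1" unfolding k_def by linarith
    have "\<bar>rnorm ((n * t) *\<^sub>R v) - rnorm (real k *\<^sub>R v)\<bar> \<le> rnorm ((n * t - k) *\<^sub>R v)"
      using rnorm_diff_le[of "(n * t) *\<^sub>R v" "real k *\<^sub>R v"] by (simp add: scaleR_left_diff_distrib)
    also have "\<dots> \<le> \<bar>n * t - k\<bar> * norm1 v" using rnorm_le[of "(n * t - k) *\<^sub>R v"] by (simp add: norm1_scaleR)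
    also have "\<dots> \<le> 1 * norm1 v" using k by (intro mult_right_mono norm1_nonneg)
    finally have 1: "\<bar>n * rnorm (t *\<^sub>R v) - k * rnorm v\<bar> \<le> norm1 v"
      using rnorm_nat[of n "t *\<^sub>R v"] by (simp add: rnorm_nat)
    have "\<bar>n * t - k\<bar> * rnorm v \<le> 1 * norm1 v"
      using k rnorm_le rnorm_nonneg by (intro mult_mono) auto
    then have "\<bar>(n * t - k) * rnorm v\<bar> \<le> norm1 v" by (simp add: abs_mult rnorm_nonneg)
    with 1 have "\<bar>n * rnorm (t *\<^sub>R v) - n * t * rnorm v\<bar> \<le> 2 * norm1 v"
      by (simp add: left_diff_distrib)
    moreover have "\<bar>n * rnorm (t *\<^sub>R v) - n * t * rnorm v\<bar> = n * \<bar>rnorm (t *\<^sub>R v) - t * rnorm v\<bar>"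
      by (metis abs_mult abs_of_nat mult.assoc right_diff_distrib)
    ultimately show ?thesis by simp
  qed
  show ?thesis
  proof (rule ccontr)
    assume "\<not> ?thesis"
    then have e: "\<bar>rnorm (t *\<^sub>R v) - t * rnorm v\<bar> > 0" by simp
    then obtain n :: nat where "2 * norm1 v < n * \<bar>rnorm (t *\<^sub>R v) - t * rnorm v\<bar>"
      using reals_Archimedean3 by blast
    then show False using bound[of n] by simp
  qed
qed

lemma rnorm_scale: "rnorm (t *\<^sub>R v) = \<bar>t\<bar> * rnorm v"
proof (cases "t \<ge> 0")
  case False
  then show ?thesis using rnorm_scale_nonneg[of "- t" v] rnorm_minus[of "t *\<^sub>R v"] by simp
qed (simp add: rnorm_scale_nonneg)

text \<open>A seminorm of the plane that vanishes on a line factors through the quotient by it and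
  so is the absolute value of a linear functional. Here \<open>w\<close> is u turned by a right
  angle, and s, t are the coordinates of x in the orthogonal basis u, w.\<close>

lemma rnorm_degenerate:
  assumes "u \<noteq> 0" "rnorm u = 0"
  obtains a b where "\<bar>a\<bar> \<le> 1" "\<bar>b\<bar> \<le> 1" "\<And>x. rnorm x = \<bar>a * fst x + b * snd x\<bar>"
proof -
  define e where "e = (fst u)\<^sup>2 + (snd u)\<^sup>2"
  have e: "e > 0" using assms(1) by (cases u) (auto simp: e_def sum_power2_gt_zero_iff zero_prod_def)
  define w where "w = (- snd u, fst u)"
  define a where "a = - rnorm w * snd u / e"
  define b where "b = rnorm w * fst u / e"
  have N: "rnorm x = \<bar>a * fst x + b * snd x\<bar>" for x
  proof -
    define s where "s = (fst x * fst u + snd x * snd u) / e"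
    define t where "t = (snd x * fst u - fst x * snd u) / e"
    have x: "x = s *\<^sub>R u + t *\<^sub>R w"
    proof -
      have "s * fst u - t * snd u = fst x * ((fst u)\<^sup>2 + (snd u)\<^sup>2) / e"
        "s * snd u + t * fst u = snd x * ((fst u)\<^sup>2 + (snd u)\<^sup>2) / e"
        by (simp_all add: s_def t_def diff_divide_distrib[symmetric] add_divide_distrib[symmetric] power2_eq_square algebra_simps)
      then have "s * fst u - t * snd u = fst x" "s * snd u + t * fst u = snd x"
        using e unfolding e_def[symmetric] by simp_all
      then show ?thesis by (simp add: prod_eq_iff w_def)
    qed
    have su: "rnorm (s *\<^sub>R u) = 0" using assms by (simp add: rnorm_scale)
    have "\<bar>rnorm x - rnorm (t *\<^sub>R w)\<bar> \<le> rnorm (s *\<^sub>R u)"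
      using rnorm_diff_le[of x "t *\<^sub>R w"] x by simp
    then have "rnorm x = rnorm (t *\<^sub>R w)" unfolding su by simp
    then have "rnorm x = \<bar>t\<bar> * rnorm w" by (simp add: rnorm_scale)
    also have "\<dots> = \<bar>t * rnorm w\<bar>" by (simp add: abs_mult rnorm_nonneg)
    also have "t * rnorm w = a * fst x + b * snd x"
      by (simp add: t_def a_def b_def add_divide_distrib[symmetric] algebra_simps)
    finally show ?thesis .
  qed
  show ?thesis
  proof (rule that[OF _ _ N])
    show "\<bar>a\<bar> \<le> 1" using N[of "(1, 0)"] rnorm_le[of "(1, 0)"] by (simp add: norm1_def)
    show "\<bar>b\<bar> \<le> 1" using N[of "(0, 1)"] rnorm_le[of "(0, 1)"] by (simp add: norm1_def)
  qed
qed

end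

text \<open>Such a map is close to one factoring through the integers, and images of grids in a line
  enclose no area. Rounding moves points by at most 2 and gives step bound 2 + 2 + 2, so the
  homotopy costs 4 (6 + 2)^2 n.\<close>

lemma circ_degenerate:
  fixes Q :: "int \<times> int \<Rightarrow> complex"
  assumes ab: "\<bar>a\<bar> \<le> 1" "\<bar>b\<bar> \<le> 1"
    and Q: "\<And>p q. dist (Q p) (Q q) \<le> 2 * \<bar>a * real_of_int (fst q - fst p) + b * real_of_int (snd q - snd p)\<bar>"
  shows "circ n Q \<le> 256 * n"
proof -
  define j where "j p = \<lfloor>a * real_of_int (fst p) + b * real_of_int (snd p)\<rfloor>" for p :: "int \<times> int"
  \<comment> \<open>Rounding to the integer points of the line gives a grid map all of whose cells have area zero.\<close>
  define R where "R i = Q (SOME p. j p = i)" for i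
  define Q' where "Q' p = R (j p)" for p
  have QQ': "dist (Q p) (Q' p) \<le> 2" for p
  proof -
    let ?q = "SOME q. j q = j p"
    have "j ?q = j p" by (rule someI) simp
    then have "\<bar>a * real_of_int (fst ?q - fst p) + b * real_of_int (snd ?q - snd p)\<bar> \<le> 1"
      unfolding j_def by (simp add: right_diff_distrib) linarith
    then show ?thesis using Q[of p ?q] by (simp add: Q'_def R_def)
  qed
  have step1: "step_lipschitz 2 Q"
    unfolding step_lipschitz_def
  proof (intro allI conjI)
    fix p
    show "dist (Q p) (Q (p + (1, 0))) \<le> 2" using Q[of p "p + (1, 0)"] ab by simp
    show "dist (Q p) (Q (p + (0, 1))) \<le> 2" using Q[of p "p + (0, 1)"] ab by simp
  qed
  have step: "step_lipschitz 6 Q" "step_lipschitz 6 Q'"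
  proof -
    have Q2: "dist (Q p) (Q (p + (1, 0))) \<le> 2" "dist (Q p) (Q (p + (0, 1))) \<le> 2" for p
      using step1 unfolding step_lipschitz_def by blast+
    show "step_lipschitz 6 Q" unfolding step_lipschitz_def
    proof (intro allI conjI)
      fix p
      show "dist (Q p) (Q (p + (1, 0))) \<le> 6" using Q2(1)[of p] by simp
      show "dist (Q p) (Q (p + (0, 1))) \<le> 6" using Q2(2)[of p] by simp
    qed
    have "dist (Q' p) (Q' q) \<le> 6" if "dist (Q p) (Q q) \<le> 2" for p q
      using that QQ'[of p] QQ'[of q] dist_triangle[of "Q' p" "Q' q" "Q p"] dist_triangle[of "Q p" "Q' q" "Q q"]
      by (simp add: dist_commute)
    then show "step_lipschitz 6 Q'" unfolding step_lipschitz_def using Q2 by blast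
  qed
  have zero: "cell (1, 0) (0, 1) Q' p = 0" for p
  proof -
    define x where "x = a * real_of_int (fst p) + b * real_of_int (snd p)"
    have j: "j p = \<lfloor>x\<rfloor>" "j (p + (1, 0)) = \<lfloor>x + a\<rfloor>" "j (p + (1, 0) + (0, 1)) = \<lfloor>x + a + b\<rfloor>" "j (p + (0, 1)) = \<lfloor>x + b\<rfloor>"
      by (simp_all add: j_def x_def algebra_simps)
    \<comment> \<open>A closed walk of four steps of size at most 1 on the integers either has two
      equal opposite corners or collapses a pair of opposite edges. In each case the determinant of
      the diagonals vanishes.\<close>
    have walk: "i = k \<or> j = l \<or> (i = j \<and> l = k) \<or> (j = k \<and> l = i)"
      if "\<bar>j - i\<bar> \<le> 1" "\<bar>l - i\<bar> \<le> 1" "\<bar>k - j\<bar> \<le> 1" "\<bar>k - l\<bar> \<le> 1" for i j k l :: int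
      using that by (smt (verit))
    have st: "\<bar>\<lfloor>y + c\<rfloor> - \<lfloor>y\<rfloor>\<bar> \<le> 1" if "\<bar>c\<bar> \<le> 1" for y c :: real using that by linarith
    have "\<bar>\<lfloor>x + a\<rfloor> - \<lfloor>x\<rfloor>\<bar> \<le> 1" "\<bar>\<lfloor>x + b\<rfloor> - \<lfloor>x\<rfloor>\<bar> \<le> 1" "\<bar>\<lfloor>x + a + b\<rfloor> - \<lfloor>x + a\<rfloor>\<bar> \<le> 1"
      "\<bar>\<lfloor>x + a + b\<rfloor> - \<lfloor>x + b\<rfloor>\<bar> \<le> 1"
      using st[of a x] st[of b x] st[of b "x + a"] st[of a "x + b"] ab by (simp_all add: add_ac)
    then consider "\<lfloor>x\<rfloor> = \<lfloor>x + a + b\<rfloor>" | "\<lfloor>x + a\<rfloor> = \<lfloor>x + b\<rfloor>" | "\<lfloor>x\<rfloor> = \<lfloor>x + a\<rfloor>" "\<lfloor>x + b\<rfloor> = \<lfloor>x + a + b\<rfloor>"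
      | "\<lfloor>x + a\<rfloor> = \<lfloor>x + a + b\<rfloor>" "\<lfloor>x + b\<rfloor> = \<lfloor>x\<rfloor>"
      using walk by metis
    note corners = this
    have eq: "cell (1, 0) (0, 1) Q' p = quad (R \<lfloor>x\<rfloor>) (R \<lfloor>x + a\<rfloor>) (R \<lfloor>x + a + b\<rfloor>) (R \<lfloor>x + b\<rfloor>)"
      unfolding cell_def Q'_def j ..
    from corners show ?thesis
      unfolding eq by cases (simp_all add: quad_def cross_def algebra_simps)
  qed
  have "\<bar>circ n Q - circ n Q'\<bar> \<le> 4 * (6 + 2 :: real)\<^sup>2 * n"
    unfolding circ_def by (rule sum_cell_homotopy[OF step QQ'])
  moreover have "circ n Q' = 0" by (simp add: circ_def zero)
  ultimately show ?thesis by simp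
qed

section \<open>Normed planes\<close>

lemma embedded_plane_of_rigid:
  fixes \<Phi> :: "real \<times> real \<Rightarrow> 'b::metric_space"
  assumes rigid: "midpoint_rigid \<Phi>" and def: "\<And>u. rnorm \<Phi> u = 0 \<Longrightarrow> u = 0"
  shows "\<exists>P :: 'b set. isometrically_embedded_normed_plane P"
proof -
  define pr where "pr v = (v $ 1, v $ 2)" for v :: "real^2"
  have pr: "pr (u + v) = pr u + pr v" "pr (c *\<^sub>R u) = c *\<^sub>R pr u" "pr (u - v) = pr u - pr v" "pr u = 0 \<longleftrightarrow> u = 0" for u v c
    by (auto simp: pr_def vec_eq_iff forall_2 zero_prod_def)
  have "is_norm (\<lambda>v. rnorm \<Phi> (pr v))"
  proof -
    have "rnorm \<Phi> (pr u) = 0 \<longleftrightarrow> u = 0" for u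
      using def[of "pr u"] rnorm_0[OF rigid] pr(4)[of u] by auto
    then show ?thesis
      unfolding is_norm_def pr by (simp add: rnorm_nonneg[OF rigid] rnorm_scale[OF rigid] rnorm_triangle[OF rigid])
  qed
  moreover have "dist (\<Phi> (pr u)) (\<Phi> (pr v)) = rnorm \<Phi> (pr (u - v))" for u v
    unfolding pr using dist_rigid[OF rigid, of "pr v" "pr u"] by (simp add: dist_commute)
  ultimately show ?thesis
    unfolding isometrically_embedded_normed_plane_def
    by (intro exI[of _ "range (\<lambda>v. \<Phi> (pr v))"] exI[of _ "\<lambda>v. rnorm \<Phi> (pr v)"] exI[of _ "\<lambda>v. \<Phi> (pr v)"]) simp
qed

lemma hyperbolic_imp_no_plane:
  assumes hyp: "hyperbolic_space TYPE('a::metric_space)"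
  shows "\<not> isometrically_embedded_normed_plane (P :: 'a set)"
proof
  assume "isometrically_embedded_normed_plane P"
  then obtain N :: "real^2 \<Rightarrow> real" and f :: "real^2 \<Rightarrow> 'a" where N: "is_norm N" and f: "\<And>u v. dist (f u) (f v) = N (u - v)"
    unfolding isometrically_embedded_normed_plane_def by blast
  obtain \<delta> where hyp: "\<And>w x y z :: 'a. dist w y + dist x z \<le> max (dist w x + dist y z) (dist w z + dist x y) + 2 * \<delta>"
    using hyp unfolding hyperbolic_space_def by blast
  have scale: "N (c *\<^sub>R u) = \<bar>c\<bar> * N u" and zero: "N u = 0 \<longleftrightarrow> u = 0" for c u
    using N by (auto simp: is_norm_def)
  have minus: "N (- u) = N u" for u using scale[of "-1" u] by simp
  \<comment> \<open>The four-point inequality at a, -a, b, -b, with the pairs of antipodes on the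
    left, divided by 2.\<close>
  have approx: "N a + N b \<le> max (N (a + b)) (N (a - b)) + \<delta>" for a b
  proof -
    have "N (- a - a) = 2 * N a" "N (- b - b) = 2 * N b"
      using scale[of "-2" a] scale[of "-2" b] by (simp_all add: scaleR_2)
    moreover have "- a - - b = - (a - b)" "- a - b = - (a + b)" "- b - a = - (a + b)" by simp_all
    then have "N (- a - - b) = N (a - b)" "N (- a - b) = N (a + b)" "N (- b - a) = N (a + b)"
      by (simp_all only: minus)
    ultimately show ?thesis
      using hyp[of "f (- a)" "f a" "f (- b)" "f b"] unfolding f by (simp add: max_def split: if_splits)
  qed
  \<comment> \<open>Both sides without \<delta> are homogeneous, so scaling by a large n removes the
    constant.\<close>
  have exact: "N a + N b \<le> max (N (a + b)) (N (a - b))" for a b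
  proof (rule ccontr)
    assume "\<not> ?thesis"
    then have e: "N a + N b - max (N (a + b)) (N (a - b)) > 0" (is "?e > 0") by linarith
    obtain n :: nat where n: "\<delta> < n * ?e" using reals_Archimedean3[OF e] by blast
    have "N (real n *\<^sub>R a) + N (real n *\<^sub>R b) \<le> max (N (real n *\<^sub>R (a + b))) (N (real n *\<^sub>R (a - b))) + \<delta>"
      using approx[of "real n *\<^sub>R a" "real n *\<^sub>R b"] by (simp add: scaleR_add_right scaleR_diff_right)
    then have "n * N a + n * N b \<le> n * max (N (a + b)) (N (a - b)) + \<delta>"
      by (simp add: scale max_mult_distrib_left)
    then show False using n by (simp add: algebra_simps)
  qed
  define a b :: "real^2" where "a = (1 / N (axis 1 1)) *\<^sub>R axis 1 1" and "b = (1 / N (axis 2 1)) *\<^sub>R axis 2 1"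
  have pos: "N (axis i 1) > 0" for i :: 2
  proof -
    have "N (axis i 1) \<noteq> 0" by (simp add: zero axis_eq_0_iff)
    moreover have "N (axis i 1) \<ge> 0" using N by (simp add: is_norm_def)
    ultimately show ?thesis by simp
  qed
  have 1: "N a = 1" "N b = 1" using pos[of 1] pos[of 2] by (simp_all add: a_def b_def scale)
  have "a $ 2 = 0" "b $ 2 \<noteq> 0" using pos[of 2] by (simp_all add: a_def b_def axis_def)
  then have "(a + b) $ 2 \<noteq> 0" "(a - b) $ 2 \<noteq> 0" by simp_all
  then have "a + b \<noteq> 0" "a - b \<noteq> 0" by (metis zero_index)+
  then have "N (a + b) \<noteq> 0" "N (a - b) \<noteq> 0" by (simp_all only: zero not_False_eq_True)
  then have "N (a + b) > 0" "N (a - b) > 0" using N by (simp_all add: is_norm_def order_less_le)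
  \<comment> \<open>Applied to a + b and a - b the inequality bounds this sum by 2. Both summands
    are positive, so each is less than 2, against N a + N b = 2.\<close>
  moreover have "N (a + b) + N (a - b) \<le> 2"
  proof -
    have "(a + b) + (a - b) = 2 *\<^sub>R a" "(a + b) - (a - b) = 2 *\<^sub>R b" by (simp_all add: scaleR_2)
    then show ?thesis using exact[of "a + b" "a - b"] 1 by (simp add: scale)
  qed
  ultimately show False using exact[of a b] 1 by (simp add: max_def split: if_splits)
qed

lemma exists_flat_spot_if_not_hyperbolic:
  fixes \<sigma> :: "'a::metric_space \<Rightarrow> 'a \<Rightarrow> real \<Rightarrow> 'a"
  assumes cb: "consistent_bicombing \<sigma>" and nh: "\<not> hyperbolic_space TYPE('a)"
    and k: "k > 0" and m0: "m0 > 0" and V: "finite V" and \<eta>: "\<eta> > 0"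
  shows "\<exists>F p (\<phi> :: 'a \<Rightarrow> complex). step_lipschitz (1 / real k) F \<and> (\<forall>x y. dist (\<phi> x) (\<phi> y) \<le> 2 * dist x y) \<and>
       (\<forall>q\<in>V. \<forall>v\<in>V. defect v F (p + q) \<le> \<eta>) \<and>
       (\<Sum>q\<in>grid m0. cell (int k, 0) (0, int k) (\<phi> \<circ> F) (p + nmult k q)) \<ge> (real m0)\<^sup>2 / 800000"
proof -
  have "1 / real k > 0" "(1 / 200000 :: real) > 0" using k by simp_all
  from exists_flat_spot[OF midpoint_map[OF cb] V this \<eta> k m0]
  obtain n0 where n0: "\<And>n (\<phi> :: 'a \<Rightarrow> complex) F0. n \<ge> n0 \<Longrightarrow> \<forall>x y. dist (\<phi> x) (\<phi> y) \<le> 2 * dist x y \<Longrightarrow> step_lipschitz (1 / real k) F0 \<Longrightarrow>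
      circ n (\<phi> \<circ> F0) \<ge> 1 / 200000 * (1 / real k)\<^sup>2 * (real n)\<^sup>2 \<Longrightarrow>
     (\<exists>F p. step_lipschitz (1 / real k) F \<and> (\<forall>q\<in>V. \<forall>v\<in>V. defect v F (p + q) \<le> \<eta>) \<and>
       (\<Sum>q\<in>grid m0. cell (int k, 0) (0, int k) (\<phi> \<circ> F) (p + nmult k q)) \<ge> 1 / 200000 / 4 * (1 / real k * k * m0)\<^sup>2)"
    by blast
  \<comment> \<open>The filling needs D at least 2, and its size n is at least D, hence beyond the
    threshold \<open>n0\<close>.\<close>
  define D0 where "D0 = max 2 (real n0)"
  have D0: "D0 > 0" by (simp add: D0_def)
  then have "\<not> thin \<sigma> D0" using thin_imp_hyperbolic[OF cb, of D0] nh by (meson less_imp_le)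
  then obtain D a \<tau> where D: "D \<ge> D0" "fat_hexagon \<sigma> D a \<tau>"
    using not_thin_imp_fat_hexagon[OF cb _ D0] by blast
  then have "D \<ge> 2" by (simp add: D0_def)
  then obtain n F0 and \<phi> :: "'a \<Rightarrow> complex" where n: "real n \<ge> D" and F0: "step_lipschitz (1 / k) F0"
    and phi: "\<And>x y. dist (\<phi> x) (\<phi> y) \<le> 2 * dist x y"
    and circ: "circ n (\<phi> \<circ> F0) \<ge> 1 / 200000 * (1 / k)\<^sup>2 * (real n)\<^sup>2"
    using fat_hexagon_filling[OF cb D(2) _ k] by metis
  have "n \<ge> n0" using n D(1) by (simp add: D0_def)
  from n0[OF this _ F0 circ] phi obtain F p where "step_lipschitz (1 / real k) F" "\<forall>q\<in>V. \<forall>v\<in>V. defect v F (p + q) \<le> \<eta>"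
      and ge: "(\<Sum>q\<in>grid m0. cell (int k, 0) (0, int k) (\<phi> \<circ> F) (p + nmult k q)) \<ge> 1 / 200000 / 4 * (1 / real k * k * m0)\<^sup>2"
    by blast
  moreover have "1 / 200000 / 4 * (1 / real k * k * m0)\<^sup>2 = (real m0)\<^sup>2 / 800000" using k by simp
  ultimately show ?thesis using phi by metis
qed

theorem theorem1p1:
  fixes \<sigma> :: "'a::metric_space \<Rightarrow> 'a \<Rightarrow> real \<Rightarrow> 'a"
  assumes "proper_metric_space TYPE('a)"
    and "consistent_bicombing \<sigma>"
    and "cocompact_isometry_group TYPE('a)"
  shows "hyperbolic_space TYPE('a) \<longleftrightarrow>
           \<not> (\<exists>P::'a set. isometrically_embedded_normed_plane P)"
proof
  show "\<not> (\<exists>P::'a set. isometrically_embedded_normed_plane P)" if "hyperbolic_space TYPE('a)"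
    using hyperbolic_imp_no_plane[OF that] by blast
next
  assume no_plane: "\<not> (\<exists>P::'a set. isometrically_embedded_normed_plane P)"
  show "hyperbolic_space TYPE('a)"
  proof (rule ccontr)
    assume nh: "\<not> hyperbolic_space TYPE('a)"
    \<comment> \<open>Any value above 256 * 800000 = 204800000 makes m0^2/800000 exceed the linear
      bound 256 m0 of the degenerate case.\<close>
    define m0 :: nat where "m0 = 300000000"
    have m0: "m0 > 0" by (simp add: m0_def)
    obtain \<Phi> :: "real \<times> real \<Rightarrow> 'a" and P where rigid: "midpoint_rigid \<Phi>"
      and P: "\<And>x y. dist (P x) (P y) \<le> 2 * dist (\<Phi> x) (\<Phi> y)" and circ: "circ m0 (P \<circ> lattice_point) \<ge> (real m0)\<^sup>2 / 800000"
      by (rule rigid_limit[OF assms(1,3) exists_flat_spot_if_not_hyperbolic[OF assms(2) nh]]) (rule m0 | assumption | blast)+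
    \<comment> \<open>Without an embedded plane the seminorm must be degenerate, and then the area
      of the limit map grows only linearly.\<close>
    obtain u where "u \<noteq> 0" "rnorm \<Phi> u = 0" using embedded_plane_of_rigid[OF rigid] no_plane by blast
    then obtain a b where ab: "\<bar>a\<bar> \<le> 1" "\<bar>b\<bar> \<le> 1" "\<And>x. rnorm \<Phi> x = \<bar>a * fst x + b * snd x\<bar>"
      using rnorm_degenerate[OF rigid] by metis
    have "circ m0 (P \<circ> lattice_point) \<le> 256 * m0"
    proof (rule circ_degenerate[OF ab(1,2)])
      fix p q :: "int \<times> int"
      show "dist ((P \<circ> lattice_point) p) ((P \<circ> lattice_point) q)
        \<le> 2 * \<bar>a * real_of_int (fst q - fst p) + b * real_of_int (snd q - snd p)\<bar>"
        using P[of "lattice_point p" "lattice_point q"] unfolding dist_rigid[OF rigid] ab(3)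
        by (simp add: lattice_point_def)
    qed
    then have "(real m0)\<^sup>2 / 800000 \<le> 256 * m0" using circ by simp
    then show False by (simp add: m0_def)
  qed
qed

end
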